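(* Let $X$ be a Cantor space. There exists $f \in HM(X;1!)$ which is a conjugacy transitive element for $CM(X;1)$. The set $HM(X;1!) \cap WM(X)$ is a dense $G_{\delta}$ subset of $CM(X;1)$.
   Context: A Cantor space is a nonempty, compact, zero-dimensional, perfect metric space (metric $d$). $C_s(X)$ is the space of continuous surjections $X\to X$ with the sup metric; $H(X)$ is the group of homeomorphisms, acting by $f\mapsto h\circ f\circ h^{-1}$, with orbits called conjugacy classes. With $V_\epsilon=\{(x,y):d(x,y)<\epsilon\}$ and maps identified with their graphs, $f$ is chain mixing if for every $\epsilon>0$ there is $N\ge1$ with $(V_\epsilon\circ f\circ V_\epsilon)^N=X\times X$ (composition of relations). $CM(X;1)$ is the (closed, conjugacy invariant) set of chain mixing maps in $C_s(X)$ which admit a fixed point. $HM(X;1!)$ (also written $H(X;1!)$) is the set of homeomorphisms $f$ of $X$ which admit a unique fixed point and such that for every $x\in X$ not fixed by $f$ the orbit $\{f^i(x):i\in\mathbb{Z}\}$ is dense in $X$. $WM(X)$ is the set of weak mixing maps $f \in C_s(X)$, i.e. those with $f\times f$ topologically transitive on $X\times X$ (for all nonempty open $U,V\subset X\times X$ there is $n\ge1$ with $(f\times f)^n(U)\cap V\neq\emptyset$). An element $f$ of a closed, conjugacy invariant set $K\subset C_s(X)$ is a conjugacy transitive element for $K$ if $K$ is the closure of the conjugacy class of $f$. *)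

theory Defs
  imports "HOL-Analysis.Analysis"
begin

text \<open>
  The space $X$ is the whole of a type of class \<^class>\<open>metric_space\<close>. Nonemptiness is automatic,
  as every type is inhabited.
\<close>

definition cantor_space :: "'a::metric_space itself \<Rightarrow> bool" where
  "cantor_space _ \<longleftrightarrow>
     compact (UNIV :: 'a set) \<and>
     (\<exists>B :: 'a set set. topological_basis B \<and> (\<forall>C\<in>B. open C \<and> closed C)) \<and>
     (\<forall>x :: 'a. x islimpt UNIV)"

text \<open>
  Self-maps of $X$ are elements of the type of bounded continuous functions, whose metric is
  the sup metric. On a compact space the boundedness is no restriction:
\<close>

lemma compact_continuous_is_bcontfun:
  fixes f :: "'a::metric_space \<Rightarrow> 'a"
  assumes "compact (UNIV :: 'a set)" and "continuous_on UNIV f"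
  shows "\<exists>g :: 'a \<Rightarrow>\<^sub>C 'a. apply_bcontfun g = f"
proof -
  have "f \<in> bcontfun"
    using assms compact_continuous_image compact_imp_bounded
    unfolding bcontfun_def by blast
  then show ?thesis
    by (metis bcontfunE)
qed

definition cont_surj :: "('a::metric_space \<Rightarrow>\<^sub>C 'a) set" where
  "cont_surj = {f. surj (apply_bcontfun f)}"

definition homeos :: "('a::metric_space \<Rightarrow>\<^sub>C 'a) set" where
  "homeos = {h. \<exists>k. homeomorphism UNIV UNIV (apply_bcontfun h) k}"

definition conj_class :: "('a::metric_space \<Rightarrow>\<^sub>C 'a) \<Rightarrow> ('a \<Rightarrow>\<^sub>C 'a) set" where
  "conj_class f =
     {g. \<exists>h\<in>homeos. apply_bcontfun g = apply_bcontfun h \<circ> apply_bcontfun f \<circ> inv (apply_bcontfun h)}"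

definition conj_invariant :: "('a::metric_space \<Rightarrow>\<^sub>C 'a) set \<Rightarrow> bool" where
  "conj_invariant K \<longleftrightarrow> (\<forall>f\<in>K. conj_class f \<subseteq> K)"

definition conj_transitive_element :: "('a::metric_space \<Rightarrow>\<^sub>C 'a) \<Rightarrow> ('a \<Rightarrow>\<^sub>C 'a) set \<Rightarrow> bool" where
  "conj_transitive_element f K \<longleftrightarrow>
     closedin (top_of_set cont_surj) K \<and> conj_invariant K \<and> f \<in> K \<and>
     K = top_of_set cont_surj closure_of conj_class f"

definition V_rel :: "real \<Rightarrow> ('a::metric_space \<times> 'a) set" where
  "V_rel \<epsilon> = {(x, y). dist x y < \<epsilon>}"

definition fun_rel :: "('a \<Rightarrow> 'a) \<Rightarrow> ('a \<times> 'a) set" where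
  "fun_rel f = {(x, f x) | x. True}"

text \<open>
  \<^term>\<open>R O S\<close> applies \<^term>\<open>R\<close> first, the reverse of the usual order for maps; the composite below
  is a palindrome, so the two conventions agree.
\<close>

definition chain_mixing :: "('a::metric_space \<Rightarrow> 'a) \<Rightarrow> bool" where
  "chain_mixing f \<longleftrightarrow>
     (\<forall>\<epsilon>>0. \<exists>N\<ge>1::nat. (V_rel \<epsilon> O fun_rel f O V_rel \<epsilon>) ^^ N = UNIV)"

definition CM1 :: "('a::metric_space \<Rightarrow>\<^sub>C 'a) set" where
  "CM1 = {f \<in> cont_surj. chain_mixing (apply_bcontfun f) \<and> (\<exists>x. apply_bcontfun f x = x)}"

definition iterate :: "('a \<Rightarrow> 'a) \<Rightarrow> int \<Rightarrow> 'a \<Rightarrow> 'a" where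
  "iterate f i = (if 0 \<le> i then f ^^ nat i else inv f ^^ nat (- i))"

definition HM1u :: "('a::metric_space \<Rightarrow>\<^sub>C 'a) set" where
  "HM1u = {f \<in> homeos. (\<exists>!x. apply_bcontfun f x = x) \<and>
     (\<forall>x. apply_bcontfun f x \<noteq> x \<longrightarrow> closure (range (\<lambda>i. iterate (apply_bcontfun f) i x)) = UNIV)}"

definition topologically_transitive :: "('a::topological_space \<Rightarrow> 'a) \<Rightarrow> bool" where
  "topologically_transitive f \<longleftrightarrow>
     (\<forall>U V. open U \<and> open V \<and> U \<noteq> {} \<and> V \<noteq> {} \<longrightarrow> (\<exists>n\<ge>1::nat. (f ^^ n) ` U \<inter> V \<noteq> {}))"

definition WM :: "('a::metric_space \<Rightarrow>\<^sub>C 'a) set" where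
  "WM = {f \<in> cont_surj. topologically_transitive (map_prod (apply_bcontfun f) (apply_bcontfun f))}"

end

theory Submission
  imports Defs
begin

text \<open>
Call a homeomorphism generic if it lies in \<^term>\<open>HM1u \<inter> WM\<close>: one fixed point, every other
two-sided orbit dense, weakly mixing. The theorem says that generic maps form a dense
\<open>G\<^sub>\<delta>\<close> set in \<^term>\<open>CM1\<close> and that the conjugacy class of one of them is dense there.

Density is a matter of symbolic labelling, and it needs very little of the map that is conjugated:
the conjugacy class of every homeomorphism \<open>g\<close> with an infinite orbit comes arbitrarily close to
every \<open>f\<close> in \<^term>\<open>CM1\<close> (\<open>conj_class_approximates\<close>). Cut the space into small clopen cells and
draw an edge from a cell to each cell that its \<open>f\<close>-image meets. As \<open>f\<close> is chain mixing,
this finite graph is strongly connected; the cell of a fixed point carries a loop. So there is a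
closed walk \<open>w\<close> of some length \<open>L\<close> that starts at the loop and visits every cell. Around a point
with infinite \<open>g\<close>-orbit choose a clopen set \<open>A\<close> disjoint from its images under
\<open>g, \<dots>, g\<^bsup>L - 1\<^esup>\<close>. Label the points of \<open>g\<^bsup>i\<^esup> A\<close> by \<open>w i\<close> for \<open>i < L\<close> and all
remaining points by the loop; then \<open>g\<close> moves labels along edges. All nonempty clopen sets of a
Cantor space are homeomorphic (\<open>homeomorphic_cantor_set\<close>), so some homeomorphism \<open>h\<close> carries
each label class onto the cell it names, and \<open>h \<circ> g \<circ> h\<^bsup>-1\<^esup>\<close> is uniformly close to \<open>f\<close>.

It remains to find one generic homeomorphism. It is the shift on the orbit closure of the
indicator function of a set of integers, namely the set of all finite sums of a fast growing
sequence \<open>t\<^sub>0, t\<^sub>1, \<dots>\<close> (\<open>generic_on_subshift\<close>). Because \<open>t\<^sub>k\<close> exceeds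
\<open>t\<^sub>0 + \<dots> + t\<^bsub>k-1\<^esub>\<close> by a gap that tends to infinity, this set looks near
each sum of terms of high index exactly as it does near zero. This
gives the fixed point \<open>0\<close> and the density of all other orbits. Weak mixing comes from the choice
\<open>t\<^bsub>k+1\<^esub> = 2 t\<^sub>k + c\<^sub>k\<close>, where \<open>c\<close> takes every natural number as a value
infinitely often: the return times \<open>t\<^sub>k\<close> and \<open>t\<^bsub>k+1\<^esub> - t\<^sub>k\<close> then differ by any prescribed
amount.

Generic maps belong to \<^term>\<open>CM1\<close>, because transitivity connects all points with the fixed
point by chains and waiting at the fixed point makes the lengths of these chains equal. That they
form a \<open>G\<^sub>\<delta>\<close> set follows from compactness, which turns each defining
property into countably many open conditions (\<open>generic_iff_countable_conditions\<close>).
\<close>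

section \<open>Cantor sets are homeomorphic to the space of binary sequences\<close>

lemma open_fun_finite_coordinates:
  fixes x :: "'i \<Rightarrow> 'b::topological_space"
  assumes "open U" "x \<in> U"
  shows "\<exists>F. finite F \<and> (\<forall>y. (\<forall>i\<in>F. y i = x i) \<longrightarrow> y \<in> U)"
proof -
  obtain X where X: "x \<in> Pi\<^sub>E UNIV X" "finite {i. X i \<noteq> UNIV}" "Pi\<^sub>E UNIV X \<subseteq> U"
    using product_topology_open_contains_basis[of "\<lambda>_. euclidean" UNIV U x] assms
    unfolding open_fun_def by auto
  have "y \<in> U" if "\<forall>i\<in>{i. X i \<noteq> UNIV}. y i = x i" for y
  proof -
    have "y i \<in> X i" for i using X(1) that by (cases "X i = UNIV") (auto simp: PiE_iff)
    then show "y \<in> U" using X(3) by (auto simp: PiE_iff)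
  qed
  then show ?thesis using X(2) by blast
qed

lemma closure_fun_discreteI:
  fixes x :: "'i \<Rightarrow> 'b::topological_space"
  assumes "\<And>F. finite F \<Longrightarrow> \<exists>y\<in>S. \<forall>i\<in>F. y i = x i"
  shows "x \<in> closure S"
  unfolding closure_iff_nhds_not_empty
proof (intro allI impI)
  fix A U assume "U \<subseteq> A" "open U" "x \<in> U"
  obtain F where F: "finite F" "\<forall>y. (\<forall>i\<in>F. y i = x i) \<longrightarrow> y \<in> U"
    using open_fun_finite_coordinates[OF \<open>open U\<close> \<open>x \<in> U\<close>] by blast
  obtain y where "y \<in> S" "\<forall>i\<in>F. y i = x i" using assms[OF F(1)] by blast
  then have "y \<in> S \<inter> A" using F(2) \<open>U \<subseteq> A\<close> by blast
  then show "S \<inter> A \<noteq> {}" by blast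
qed

definition splits :: "'a set \<Rightarrow> 'a set \<Rightarrow> bool" where
  "splits D A \<longleftrightarrow> D \<inter> A \<noteq> {} \<and> D - A \<noteq> {}"

text \<open>
A cell is always cut by one of the given sets, and at stage \<open>n\<close> by \<open>C n\<close> whenever this is possible.
Any two points separated by \<open>C n\<close> are therefore in different cells after stage \<open>n\<close>.
\<close>

definition split_index :: "(nat \<Rightarrow> 'a set) \<Rightarrow> 'a set \<Rightarrow> nat \<Rightarrow> nat" where
  "split_index C D n = (if splits D (C n) then n else (SOME m. splits D (C m)))"

text \<open>
The cell of \<open>x\<close> after \<open>n\<close> binary cuts. The cut of a cell depends on the cell alone, so the cells of
stage \<open>n\<close> form a partition.
\<close>

primrec cell :: "(nat \<Rightarrow> 'a set) \<Rightarrow> 'a set \<Rightarrow> 'a \<Rightarrow> nat \<Rightarrow> 'a set" where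
  "cell C K x 0 = K"
| "cell C K x (Suc n) =
     {y \<in> cell C K x n. y \<in> C (split_index C (cell C K x n) n)
                    \<longleftrightarrow> x \<in> C (split_index C (cell C K x n) n)}"

definition itinerary :: "(nat \<Rightarrow> 'a set) \<Rightarrow> 'a set \<Rightarrow> 'a \<Rightarrow> nat \<Rightarrow> bool" where
  "itinerary C K x n \<longleftrightarrow> x \<in> C (split_index C (cell C K x n) n)"

lemma cell_Suc: "cell C K x (Suc n) =
    {y \<in> cell C K x n. (y \<in> C (split_index C (cell C K x n) n)) = itinerary C K x n}"
  by (simp add: itinerary_def)

lemma mem_cell: "x \<in> K \<Longrightarrow> x \<in> cell C K x n"
  by (induction n) auto

lemma cell_antimono: "m \<le> n \<Longrightarrow> cell C K x n \<subseteq> cell C K x m"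
  by (induction n rule: dec_induct) auto

lemma cell_eq: "y \<in> cell C K x n \<Longrightarrow> cell C K y n = cell C K x n"
  by (induction n) auto

lemma itinerary_eq: "y \<in> cell C K x n \<Longrightarrow> i < n \<Longrightarrow> itinerary C K y i = itinerary C K x i"
proof -
  assume y: "y \<in> cell C K x n" and i: "i < n"
  have "y \<in> cell C K x (Suc i)" using y cell_antimono[of "Suc i" n C K x] i by auto
  moreover from this have "cell C K y i = cell C K x i" by (intro cell_eq) simp
  ultimately show ?thesis by (simp add: itinerary_def)
qed

lemma cell_eq_if_itinerary_eq:
  "(\<And>i. i < n \<Longrightarrow> itinerary C K y i = itinerary C K x i) \<Longrightarrow> cell C K y n = cell C K x n"
  by (induction n) (auto simp: cell_Suc simp del: cell.simps(2))

text \<open>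
Brouwer's characterisation of the Cantor set, for a compact space with a sequence of clopen sets that
separates points. The homeomorphism sends a point to the sequence of sides it takes in the successive
cuts. It is continuous since each side is locally constant, injective since \<open>C n\<close> is used at
stage \<open>n\<close> if it is still needed, and its image is dense since no cell is a single point, so that
both sides of each cut are occupied.
\<close>

lemma homeomorphic_cantor_set:
  fixes K :: "'a::topological_space set" and C :: "nat \<Rightarrow> 'a set"
  assumes K: "compact K" "K \<noteq> {}"
    and clopen: "\<And>n. openin (top_of_set K) (K \<inter> C n)" "\<And>n. openin (top_of_set K) (K - C n)"
    and separating: "\<And>x y. x \<in> K \<Longrightarrow> y \<in> K \<Longrightarrow> x \<noteq> y \<Longrightarrow> \<exists>n. (x \<in> C n) \<noteq> (y \<in> C n)"
    and perfect: "\<And>x. x \<in> K \<Longrightarrow> \<not> openin (top_of_set K) {x}"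
  shows "K homeomorphic (UNIV :: (nat \<Rightarrow> bool) set)"
proof -
  let ?D = "cell C K" and ?\<phi> = "itinerary C K"
  have sub: "?D x n \<subseteq> K" for x n
    using cell_antimono[of 0 n C K x] by simp
  have op: "openin (top_of_set K) (?D x n)" for x n
  proof (induction n)
    case 0 show ?case by simp
  next
    case (Suc n)
    let ?A = "C (split_index C (?D x n) n)"
    have "?D x (Suc n) = ?D x n \<inter> (if ?\<phi> x n then K \<inter> ?A else K - ?A)"
      using sub[of x n] by (auto simp: itinerary_def)
    moreover have "openin (top_of_set K) (if ?\<phi> x n then K \<inter> ?A else K - ?A)"
      using clopen by simp
    ultimately show ?case using Suc by (simp only: openin_Int)
  qed
  have split: "splits (?D x n) (C (split_index C (?D x n) n))" if xK: "x \<in> K" for x n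
  proof -
    have x: "x \<in> ?D x n" by (rule mem_cell[OF xK])
    have "?D x n \<noteq> {x}" using perfect[OF xK] op[of x n] by auto
    then obtain y where y: "y \<in> ?D x n" "y \<noteq> x" using x by blast
    with sub have "y \<in> K" by blast
    then obtain m where "(x \<in> C m) \<noteq> (y \<in> C m)" using separating[OF xK] y(2) by blast
    with x y have "splits (?D x n) (C m)" unfolding splits_def by blast
    then have "splits (?D x n) (C (SOME m. splits (?D x n) (C m)))" by (rule someI)
    then show ?thesis by (simp add: split_index_def)
  qed
  have inj: "inj_on ?\<phi> K"
  proof (rule inj_onI, rule ccontr)
    fix x y assume xy: "x \<in> K" "y \<in> K" "?\<phi> x = ?\<phi> y" "x \<noteq> y"
    have y: "y \<in> ?D x n" for n
      using cell_eq_if_itinerary_eq[of n C K y x] mem_cell[OF xy(2), of C n] xy(3) by simp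
    from separating xy obtain n where n: "(x \<in> C n) \<noteq> (y \<in> C n)" by blast
    then have "splits (?D x n) (C n)"
      unfolding splits_def using y[of n] mem_cell[OF xy(1), of C n] by auto
    then have "split_index C (?D x n) n = n" by (simp add: split_index_def)
    then show False using y[of "Suc n"] n by simp
  qed
  have cont: "continuous_on K ?\<phi>"
  proof (rule continuous_on_coordinatewise_then_product)
    fix n
    have "openin (top_of_set K) (K \<inter> (\<lambda>x. ?\<phi> x n) -` B)" for B
    proof (subst openin_subopen, safe)
      fix x assume x: "x \<in> K" "?\<phi> x n \<in> B"
      have "y \<in> K \<inter> (\<lambda>x. ?\<phi> x n) -` B" if "y \<in> ?D x (Suc n)" for y
        using x(2) sub[of x "Suc n"] itinerary_eq[OF that, of n] that by (simp del: cell.simps) blast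
      then show "\<exists>T. openin (top_of_set K) T \<and> x \<in> T \<and> T \<subseteq> K \<inter> (\<lambda>x. ?\<phi> x n) -` B"
        using op[of x "Suc n"] mem_cell[OF x(1), of C "Suc n"] by (intro exI[of _ "?D x (Suc n)"]) blast
    qed
    then show "continuous_on K (\<lambda>x. ?\<phi> x n)"
      unfolding continuous_openin_preimage_eq by blast
  qed
  have approx: "\<exists>x\<in>K. \<forall>i<n. ?\<phi> x i = b i" for b n
  proof (induction n)
    case 0 then show ?case using K(2) by auto
  next
    case (Suc n)
    then obtain x where x: "x \<in> K" "\<forall>i<n. ?\<phi> x i = b i" by blast
    let ?A = "C (split_index C (?D x n) n)"
    obtain y where y: "y \<in> ?D x n" "(y \<in> ?A) = b n"
      using split[OF x(1), of n] unfolding splits_def by (cases "b n") auto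
    have "?\<phi> y n = b n" using y cell_eq[OF y(1)] by (simp add: itinerary_def)
    moreover have "?\<phi> y i = b i" if "i < n" for i
      using itinerary_eq[OF y(1) that] x(2) that by simp
    ultimately show ?case using y(1) sub less_Suc_eq by blast
  qed
  have "Hausdorff_space (euclidean :: bool topology)"
    unfolding Hausdorff_space_def disjnt_def by (metis hausdorff open_openin)
  then have "Hausdorff_space (product_topology (\<lambda>_ :: nat. euclidean :: bool topology) UNIV)"
    by (simp add: Hausdorff_space_product_topology)
  then have Hausdorff: "Hausdorff_space (euclidean :: (nat \<Rightarrow> bool) topology)"
    by (simp add: euclidean_product_topology)
  have onto: "?\<phi> ` K = UNIV"
  proof -
    have "compactin euclidean (?\<phi> ` K)"
      using compact_continuous_image[OF cont K(1)] by simp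
    then have "closed (?\<phi> ` K)"
      using compactin_imp_closedin[OF Hausdorff] by simp
    moreover have "b \<in> closure (?\<phi> ` K)" for b
    proof (rule closure_fun_discreteI)
      fix F :: "nat set" assume "finite F"
      then obtain n where "F \<subseteq> {..<n}" using finite_nat_iff_bounded by blast
      with approx[of n b] show "\<exists>y\<in>?\<phi> ` K. \<forall>i\<in>F. y i = b i" by blast
    qed
    ultimately show ?thesis by auto
  qed
  have "homeomorphic_map (top_of_set K) euclidean ?\<phi>"
    using Hausdorff cont inj onto K(1)
    by (intro continuous_imp_homeomorphic_map) (auto simp: compact_space_subtopology)
  then obtain \<psi> where "homeomorphic_maps (top_of_set K) euclidean ?\<phi> \<psi>"
    unfolding homeomorphic_map_maps by blast
  then have \<psi>: "continuous_map euclidean (top_of_set K) \<psi>"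
      "\<And>x. x \<in> K \<Longrightarrow> \<psi> (?\<phi> x) = x" "\<And>b. ?\<phi> (\<psi> b) = b"
    by (simp_all add: homeomorphic_maps_def)
  have "continuous_on UNIV \<psi>" "range \<psi> \<subseteq> K"
    using \<psi>(1) by (auto simp: continuous_map_in_subtopology)
  moreover have "K \<subseteq> range \<psi>" using \<psi>(2) by (metis rangeI subsetI)
  ultimately have "homeomorphism K UNIV ?\<phi> \<psi>"
    using \<psi>(2,3) onto cont by (intro homeomorphismI) auto
  then show ?thesis unfolding homeomorphic_def by blast
qed

section \<open>A weakly mixing subshift with one fixed point\<close>

text \<open>
The increments \<open>fst (prod_decode i)\<close> serve only as a sequence in which every natural number occurs
infinitely often.
\<close>

primrec rtime :: "nat \<Rightarrow> int" where
  "rtime 0 = 1"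
| "rtime (Suc i) = 2 * rtime i + int (fst (prod_decode i))"

definition gap :: "nat \<Rightarrow> int" where
  "gap k = 1 + (\<Sum>j<k. int (fst (prod_decode j)))"

text \<open>
The number \<open>gap k\<close> is the distance from \<open>rtime k\<close> to the largest sum of earlier terms; it measures
how isolated the \<open>k\<close>-th block of return times is.
\<close>

lemma rtime_eq_gap: "rtime i = gap i + (\<Sum>j<i. rtime j)"
  by (induction i) (simp_all add: gap_def)

lemma gap_mono: "i \<le> j \<Longrightarrow> gap i \<le> gap j"
  unfolding gap_def by (intro add_left_mono sum_mono2) auto

lemma gap_pos: "gap i \<ge> 1"
  unfolding gap_def by (simp add: sum_nonneg)

lemma rtime_ge_gap: "rtime i \<ge> gap i"
proof (induction i)
  case 0 show ?case by (simp add: gap_def)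
next
  case (Suc i)
  then show ?case using gap_pos[of i] by (simp add: gap_def)
qed

lemma rtime_pos: "rtime i > 0"
  using rtime_ge_gap[of i] gap_pos[of i] by simp

lemma increment_recurs: "\<exists>n\<ge>m. rtime (Suc n) - rtime n = rtime n + int c"
  by (rule exI[of _ "prod_encode (c, m)"]) (simp add: le_prod_encode_2)

lemma gap_unbounded: "\<exists>k. gap k > B"
proof -
  let ?n = "prod_encode (nat B, 0)"
  have "gap (Suc ?n) = gap ?n + int (nat B)" by (simp add: gap_def)
  then have "gap (Suc ?n) > B" using gap_pos[of ?n] by linarith
  then show ?thesis ..
qed

lemma rtime_nonneg: "rtime i \<ge> 0"
  using rtime_pos[of i] by simp

definition return_times :: "nat \<Rightarrow> int set" where
  "return_times k = {sum rtime F | F. finite F \<and> F \<subseteq> {k..}}"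

lemma return_timesI: "finite F \<Longrightarrow> F \<subseteq> {k..} \<Longrightarrow> sum rtime F \<in> return_times k"
  unfolding return_times_def by blast

lemma rtime_in_return_times: "k \<le> i \<Longrightarrow> rtime i \<in> return_times k"
  using return_timesI[of "{i}" k] by simp

lemma zero_in_return_times: "0 \<in> return_times k"
  using return_timesI[of "{}" k] by simp

lemma return_times_nonneg: "w \<in> return_times k \<Longrightarrow> w \<ge> 0"
  unfolding return_times_def by (auto intro: sum_nonneg rtime_nonneg)

lemma sum_rtime_split:
  assumes "finite F"
  shows "sum rtime F = sum rtime (F \<inter> {..<k}) + sum rtime (F \<inter> {k..})"
proof -
  have "F - {..<k} = F \<inter> {k..}" by auto
  then show ?thesis using sum.Int_Diff[OF assms, of rtime "{..<k}"] by simp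
qed

lemma sum_rtime_below: "finite F \<Longrightarrow> sum rtime (F \<inter> {..<k}) \<le> (\<Sum>j<k. rtime j)"
  by (intro sum_mono2) (auto intro: rtime_nonneg)

text \<open>
At the largest index where two finite sets differ, the term \<open>rtime i\<close> outweighs everything that lower
indices can contribute by at least \<open>gap i\<close>. As in a numeral system, the highest differing digit
decides.
\<close>

lemma sum_rtime_diff_ge_gap:
  assumes "finite F" "finite G" "i \<in> G" "i \<notin> F" and eq: "\<And>j. j > i \<Longrightarrow> j \<in> F \<longleftrightarrow> j \<in> G"
  shows "sum rtime G - sum rtime F \<ge> gap i"
proof -
  have i: "{i..} = insert i {Suc i..}" by auto
  have "F \<inter> {Suc i..} = G \<inter> {Suc i..}" using eq by (auto simp: Suc_le_eq)
  then have F: "F \<inter> {i..} = F \<inter> {Suc i..}" and G: "G \<inter> {i..} = insert i (F \<inter> {Suc i..})"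
    using assms(3,4) unfolding i by simp_all
  have "sum rtime (G \<inter> {i..}) = rtime i + sum rtime (F \<inter> {i..})"
    unfolding G F using assms(1) by simp
  moreover have "sum rtime (G \<inter> {..<i}) \<ge> 0" by (intro sum_nonneg rtime_nonneg)
  ultimately show ?thesis
    using sum_rtime_split[OF assms(1), of i] sum_rtime_split[OF assms(2), of i]
      sum_rtime_below[OF assms(1), of i] rtime_eq_gap[of i] by linarith
qed

lemma sum_rtime_close_imp_agree:
  assumes "finite F" "finite G" "\<bar>sum rtime G - sum rtime F\<bar> < gap k" "i \<ge> k"
  shows "i \<in> F \<longleftrightarrow> i \<in> G"
proof (rule ccontr)
  let ?D = "{i. i \<ge> k \<and> (i \<in> F) \<noteq> (i \<in> G)}"
  assume "(i \<in> F) \<noteq> (i \<in> G)"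
  then have ne: "i \<in> ?D" using assms(4) by simp
  have fin: "finite ?D" by (rule finite_subset[of _ "F \<union> G"]) (use assms(1,2) in auto)
  define m where "m = Max ?D"
  have m: "m \<in> ?D" unfolding m_def using Max_in[OF fin] ne by blast
  have above: "j \<in> F \<longleftrightarrow> j \<in> G" if "j > m" for j
  proof (rule ccontr)
    assume "(j \<in> F) \<noteq> (j \<in> G)"
    then have "j \<in> ?D" using m that by auto
    then show False using Max_ge[OF fin] that unfolding m_def by force
  qed
  have "\<bar>sum rtime G - sum rtime F\<bar> \<ge> gap m"
  proof (cases "m \<in> G")
    case True
    then have "sum rtime G - sum rtime F \<ge> gap m"
      using m above by (intro sum_rtime_diff_ge_gap assms(1,2)) auto
    then show ?thesis by linarith
  next
    case False
    then have "sum rtime F - sum rtime G \<ge> gap m"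
      using m above by (intro sum_rtime_diff_ge_gap assms(1,2)) auto
    then show ?thesis by linarith
  qed
  moreover have "gap m \<ge> gap k" using m by (intro gap_mono) simp
  ultimately show False using assms(3) by linarith
qed

text \<open>
The self-similarity behind all properties of the subshift: within distance \<open>gap k\<close> of a sum \<open>q\<close> of
terms with index at least \<open>k\<close>, a finite sum must use the same high terms as \<open>q\<close>, so what
remains is a sum of low terms. Hence the set of all finite sums looks the same around \<open>q\<close> and
around \<open>0\<close>.
\<close>

lemma return_times_local:
  assumes "q \<in> return_times k" "\<bar>j\<bar> < gap k"
  shows "q + j \<in> return_times 0 \<longleftrightarrow> j \<in> return_times 0"
proof -
  obtain F where F: "finite F" "F \<subseteq> {k..}" "q = sum rtime F"
    using assms(1) unfolding return_times_def by blast
  show ?thesis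
  proof
    assume "q + j \<in> return_times 0"
    then obtain G where G: "finite G" "q + j = sum rtime G" unfolding return_times_def by blast
    have "i \<in> F \<longleftrightarrow> i \<in> G" if "i \<ge> k" for i
      using sum_rtime_close_imp_agree[OF F(1) G(1) _ that] assms(2) F(3) G(2) by simp
    then have "G \<inter> {k..} = F" using F(2) by auto
    then have "sum rtime (G \<inter> {..<k}) = j"
      using sum_rtime_split[OF G(1), of k] F(3) G(2) by simp
    then show "j \<in> return_times 0" using return_timesI[of "G \<inter> {..<k}" 0] G(1) by simp
  next
    assume "j \<in> return_times 0"
    then obtain G where G: "finite G" "j = sum rtime G" unfolding return_times_def by blast
    have "i \<notin> G" if "i \<ge> k" for i
      using sum_rtime_close_imp_agree[of "{}" G k i] that assms(2) G by simp
    then have "F \<inter> G = {}" using F(2) by auto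
    then have "q + j = sum rtime (F \<union> G)" using F(1,3) G by (simp add: sum.union_disjoint)
    then show "q + j \<in> return_times 0" using return_timesI[of "F \<union> G" 0] F(1) G(1) by simp
  qed
qed

definition shift :: "int \<Rightarrow> (int \<Rightarrow> bool) \<Rightarrow> int \<Rightarrow> bool" where
  "shift n x = (\<lambda>j. x (j + n))"

lemma shift_shift: "shift n (shift m x) = shift (n + m) x"
  unfolding shift_def by (simp add: algebra_simps)

lemma shift_0 [simp]: "shift 0 x = x"
  unfolding shift_def by simp

lemma continuous_shift: "continuous_on A (shift n)"
  unfolding shift_def
  by (intro continuous_on_coordinatewise_then_product)
     (rule continuous_on_subset[OF continuous_on_product_coordinates], simp)

definition base_point :: "int \<Rightarrow> bool" where
  "base_point j \<longleftrightarrow> j \<in> return_times 0"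

definition subshift :: "(int \<Rightarrow> bool) set" where
  "subshift = closure (range (\<lambda>n. shift n base_point))"

lemma shift_base_point_in: "shift n base_point \<in> subshift"
  unfolding subshift_def by (rule closure_subset[THEN subsetD]) simp

lemma shift_in_subshift:
  assumes "x \<in> subshift"
  shows "shift n x \<in> subshift"
proof -
  have "shift n ` range (\<lambda>m. shift m base_point) \<subseteq> range (\<lambda>m. shift m base_point)"
    by (auto simp: shift_shift)
  then have "shift n ` closure (range (\<lambda>m. shift m base_point)) \<subseteq> closure (range (\<lambda>m. shift m base_point))"
    by (intro image_closure_subset continuous_shift closed_closure) (use closure_subset in blast)
  then show ?thesis using assms unfolding subshift_def by blast
qed

lemma compact_subshift: "compact subshift"
proof -
  have "compact_space (euclidean :: bool topology)"
    unfolding compact_space_def by (simp add: finite_imp_compact)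
  then have "compact_space (product_topology (\<lambda>_ :: int. euclidean :: bool topology) UNIV)"
    by (simp add: compact_space_product_topology)
  then have "compact (UNIV :: (int \<Rightarrow> bool) set)"
    by (simp add: euclidean_product_topology compact_space_def)
  then show ?thesis
    using compact_Int_closed[of UNIV subshift] unfolding subshift_def by simp
qed

lemma open_window:
  fixes x :: "int \<Rightarrow> bool"
  assumes "open U" "x \<in> U"
  shows "\<exists>L\<ge>0. \<forall>y. (\<forall>j. \<bar>j\<bar> \<le> L \<longrightarrow> y j = x j) \<longrightarrow> y \<in> U"
proof -
  obtain F where F: "finite F" "\<forall>y. (\<forall>j\<in>F. y j = x j) \<longrightarrow> y \<in> U"
    using open_fun_finite_coordinates[OF assms] by blast
  have "\<bar>j\<bar> \<le> (\<Sum>j\<in>F. \<bar>j\<bar>)" if "j \<in> F" for j :: int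
    using that F(1) by (intro member_le_sum[of j F abs]) auto
  then show ?thesis using F(2) by (intro exI[of _ "\<Sum>j\<in>F. \<bar>j\<bar>"]) (auto simp: sum_nonneg)
qed

lemma subshift_meets_orbit:
  assumes "open U" "x \<in> U" "x \<in> subshift"
  obtains u where "shift u base_point \<in> U"
  using assms unfolding subshift_def closure_iff_nhds_not_empty by blast

lemma subshift_window:
  assumes "x \<in> subshift"
  shows "\<exists>p. \<forall>j. \<bar>j\<bar> \<le> L \<longrightarrow> x j = base_point (j + p)"
proof -
  have "open {y :: int \<Rightarrow> bool. \<forall>j\<in>{-L..L}. y j \<in> {x j}}"
    by (rule product_topology_basis'[of "{-L..L}" "\<lambda>j. {x j}" "\<lambda>j. j"]) (auto simp: open_discrete)
  then obtain u where "shift u base_point \<in> {y :: int \<Rightarrow> bool. \<forall>j\<in>{-L..L}. y j \<in> {x j}}"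
    using subshift_meets_orbit[OF _ _ assms] by blast
  then show ?thesis by (intro exI[of _ u]) (auto simp: shift_def abs_le_iff)
qed

text \<open>
Translating by a sum of high terms does not change a window of fixed size.
\<close>

lemma base_point_return:
  assumes "open U" "shift u base_point \<in> U"
  shows "\<exists>k. \<forall>q\<in>return_times k. shift (u + q) base_point \<in> U"
proof -
  obtain L where L: "L \<ge> 0" "\<forall>y. (\<forall>j. \<bar>j\<bar> \<le> L \<longrightarrow> y j = shift u base_point j) \<longrightarrow> y \<in> U"
    using open_window[OF assms] by blast
  obtain k where k: "gap k > L + \<bar>u\<bar>" using gap_unbounded by blast
  show ?thesis
  proof (intro exI[of _ k] ballI, rule L(2)[rule_format])
    fix q j assume "q \<in> return_times k" "\<bar>j\<bar> \<le> L"
    then show "shift (u + q) base_point j = shift u base_point j"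
      using return_times_local[of q k "j + u"] k by (simp add: shift_def base_point_def algebra_simps)
  qed
qed

text \<open>
If \<open>x\<close> has a one at \<open>j0\<close>, then a large window of \<open>x\<close> is copied from the base point, and the copied
one sits at a finite sum. Dropping the low terms of this sum moves the position by at most
\<open>\<Sum>i<k. rtime i\<close>, hence stays in the window, and leads to a sum \<open>q\<close> of high terms, around
which the base point looks as it does around zero. So the orbit of \<open>x\<close> comes close to the base
point, and thereby to its whole orbit.
\<close>

lemma subshift_orbit_dense:
  assumes x: "x \<in> subshift" "x \<noteq> (\<lambda>_. False)" and U: "open U" "U \<inter> subshift \<noteq> {}"
  shows "\<exists>n. shift n x \<in> U"
proof -
  obtain u where u: "shift u base_point \<in> U" using subshift_meets_orbit U by blast
  obtain L where L: "L \<ge> 0" "\<forall>y. (\<forall>j. \<bar>j\<bar> \<le> L \<longrightarrow> y j = shift u base_point j) \<longrightarrow> y \<in> U"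
    using open_window[OF U(1) u] by blast
  obtain k where k: "gap k > L + \<bar>u\<bar>" using gap_unbounded by blast
  obtain j0 where j0: "x j0" using x(2) by auto
  let ?P = "\<Sum>i<k. rtime i"
  have P: "?P \<ge> 0" by (intro sum_nonneg rtime_nonneg)
  obtain p where p: "\<forall>j. \<bar>j\<bar> \<le> L + \<bar>u\<bar> + \<bar>j0\<bar> + ?P \<longrightarrow> x j = base_point (j + p)"
    using subshift_window[OF x(1)] by blast
  have "base_point (j0 + p)" using p[rule_format, of j0] j0 L(1) P by simp
  then obtain F where F: "finite F" "j0 + p = sum rtime F" unfolding base_point_def return_times_def by blast
  define q where "q = sum rtime (F \<inter> {k..})"
  have q: "q \<in> return_times k" unfolding q_def using F(1) by (intro return_timesI) auto
  have r: "0 \<le> j0 + p - q" "j0 + p - q \<le> ?P"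
    using sum_rtime_split[OF F(1), of k] sum_rtime_below[OF F(1), of k] F(2) sum_nonneg[of "F \<inter> {..<k}" rtime] rtime_nonneg
    by (auto simp: q_def)
  have "shift (q - p + u) x \<in> U"
  proof (rule L(2)[rule_format])
    fix j assume j: "\<bar>j\<bar> \<le> L"
    have "shift (q - p + u) x j = base_point (q + (j + u))"
      using p[rule_format, of "j + (q - p + u)"] r j by (simp add: shift_def algebra_simps)
    also have "\<dots> = base_point (j + u)"
      using return_times_local[OF q, of "j + u"] k j by (simp add: base_point_def)
    finally show "shift (q - p + u) x j = shift u base_point j" by (simp add: shift_def)
  qed
  then show ?thesis ..
qed

lemma not_base_point_neg: "j < 0 \<Longrightarrow> \<not> base_point j"
  using return_times_nonneg unfolding base_point_def by fastforce

lemma base_point_0: "base_point 0"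
  unfolding base_point_def by (rule zero_in_return_times)

text \<open>
There are arbitrarily long runs of zeros immediately before the positions \<open>rtime k\<close>.
\<close>

lemma zero_in_subshift: "(\<lambda>_. False) \<in> subshift"
  unfolding subshift_def closure_iff_nhds_not_empty
proof (intro allI impI)
  fix A U :: "(int \<Rightarrow> bool) set" assume "U \<subseteq> A" "open U" "(\<lambda>_. False) \<in> U"
  obtain L where L: "L \<ge> 0" "\<forall>y. (\<forall>j. \<bar>j\<bar> \<le> L \<longrightarrow> y j = False) \<longrightarrow> y \<in> U"
    using open_window[OF \<open>open U\<close> \<open>(\<lambda>_. False) \<in> U\<close>] by blast
  obtain k where k: "gap k > 2 * L + 2" using gap_unbounded by blast
  have "shift (rtime k - 1 - L) base_point \<in> U"
  proof (rule L(2)[rule_format])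
    fix j assume "\<bar>j\<bar> \<le> L"
    then show "shift (rtime k - 1 - L) base_point j = False"
      using return_times_local[OF rtime_in_return_times[of k k], of "j - 1 - L"] k not_base_point_neg[of "j - 1 - L"]
      by (simp add: shift_def base_point_def algebra_simps)
  qed
  then show "range (\<lambda>n. shift n base_point) \<inter> A \<noteq> {}" using \<open>U \<subseteq> A\<close> by blast
qed

text \<open>
A translate of the base point is the limit of its further translates by \<open>rtime k\<close>, and these differ
from it because the base point has a leftmost one.
\<close>

lemma subshift_perfect:
  assumes "open U" "x \<in> U" "x \<in> subshift"
  shows "\<exists>y\<in>U \<inter> subshift. y \<noteq> x"
proof -
  obtain u where u: "shift u base_point \<in> U" using subshift_meets_orbit[OF assms] .
  obtain k where k: "\<forall>q\<in>return_times k. shift (u + q) base_point \<in> U"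
    using base_point_return[OF assms(1) u] by blast
  have U: "shift (u + rtime k) base_point \<in> U" using k rtime_in_return_times by simp
  have "shift u base_point (- u - rtime k) = False"
    using not_base_point_neg[of "- rtime k"] rtime_pos[of k] by (simp add: shift_def)
  moreover have "shift (u + rtime k) base_point (- u - rtime k) = True"
    by (simp add: shift_def base_point_0)
  ultimately have "shift u base_point \<noteq> shift (u + rtime k) base_point" by metis
  then obtain v where "shift v base_point \<noteq> x" "shift v base_point \<in> U" using u U by metis
  then show ?thesis using shift_base_point_in by blast
qed

lemma subshift_fixed_iff:
  assumes "x \<in> subshift"
  shows "shift 1 x = x \<longleftrightarrow> x = (\<lambda>_. False)"
proof
  assume fixed: "shift 1 x = x"
  have step: "x (j + 1) = x j" for j using fun_cong[OF fixed, of j] by (simp add: shift_def)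
  have const: "x j = x 0" for j
  proof (induction j rule: int_induct[of _ 0])
    case (step1 i) then show ?case using step[of i] by simp
  next
    case (step2 i) then show ?case using step[of "i - 1"] by simp
  qed simp
  show "x = (\<lambda>_. False)"
  proof (rule ccontr)
    assume ne: "x \<noteq> (\<lambda>_. False)"
    have "open {y :: int \<Rightarrow> bool. \<forall>j\<in>{-1}. y j \<in> {False}}"
      by (rule product_topology_basis'[of "{-1}" "\<lambda>j. {False}" "\<lambda>j. j"]) (auto simp: open_discrete)
    moreover have "base_point \<in> {y. \<forall>j\<in>{-1}. y j \<in> {False}} \<inter> subshift"
      using not_base_point_neg[of "-1"] shift_base_point_in[of 0] by simp
    ultimately obtain n where "shift n x \<in> {y. \<forall>j\<in>{-1}. y j \<in> {False}}"
      using subshift_orbit_dense[OF assms ne] by blast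
    then have "\<not> x (n - 1)" by (simp add: shift_def)
    then have "\<not> x 0" using const[of "n - 1"] by simp
    then show False using const ne by blast
  qed
qed (simp add: shift_def)

text \<open>
The four sets may be taken as neighbourhoods of translates of the base point by \<open>u1\<close>, \<open>v1\<close>,
\<open>u2\<close>, \<open>v2\<close>. A common transition time must be \<open>v1 - u1\<close> plus one difference of
return times and \<open>v2 - u2\<close> plus another. The differences \<open>rtime (Suc m) - rtime m\<close> and
\<open>rtime m\<close> do, for an \<open>m\<close> at which they differ by \<open>(v2 - u2) - (v1 - u1)\<close>; such \<open>m\<close> exist
arbitrarily far out.
\<close>

lemma subshift_weak_mixing:
  assumes "open U1" "open V1" "open U2" "open V2"
    and "U1 \<inter> subshift \<noteq> {}" "V1 \<inter> subshift \<noteq> {}" "U2 \<inter> subshift \<noteq> {}" "V2 \<inter> subshift \<noteq> {}"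
  obtains n x y where "n \<ge> 1" "x \<in> subshift" "y \<in> subshift"
    "x \<in> U1" "shift n x \<in> V1" "y \<in> U2" "shift n y \<in> V2"
proof -
  \<comment> \<open>The increments of \<open>rtime\<close> are nonnegative, so the order of the two pairs matters.\<close>
  have wlog: "\<exists>n x y. n \<ge> 1 \<and> x \<in> subshift \<and> y \<in> subshift
      \<and> x \<in> U1 \<and> shift n x \<in> V1 \<and> y \<in> U2 \<and> shift n y \<in> V2"
    if U: "open U1" "open V1" "open U2" "open V2"
      and uv: "shift u1 base_point \<in> U1" "shift v1 base_point \<in> V1" "shift u2 base_point \<in> U2" "shift v2 base_point \<in> V2"
      and c: "v2 - u2 \<ge> v1 - u1" for u1 v1 u2 v2 U1 V1 U2 V2
  proof -
    obtain k1 where k1: "\<forall>q\<in>return_times k1. shift (u1 + q) base_point \<in> U1"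
      using base_point_return[OF U(1) uv(1)] by metis
    obtain k2 where k2: "\<forall>q\<in>return_times k2. shift (v1 + q) base_point \<in> V1"
      using base_point_return[OF U(2) uv(2)] by metis
    obtain k3 where k3: "\<forall>q\<in>return_times k3. shift (v2 + q) base_point \<in> V2"
      using base_point_return[OF U(4) uv(4)] by metis
    obtain k4 where k4: "gap k4 > \<bar>v2 - u2\<bar> + 1" using gap_unbounded by blast
    obtain m where m: "m \<ge> max (max k1 k2) (max k3 k4)"
        "rtime (Suc m) - rtime m = rtime m + int (nat ((v2 - u2) - (v1 - u1)))"
      using increment_recurs by blast
    have rm: "rtime (Suc m) = 2 * rtime m + ((v2 - u2) - (v1 - u1))" using m(2) c by simp
    let ?n = "rtime m + (v2 - u2)"
    have "gap m > \<bar>v2 - u2\<bar> + 1" using k4 gap_mono[of k4 m] m(1) by linarith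
    then have n: "?n \<ge> 1" using rtime_ge_gap[of m] by linarith
    have 1: "shift (u1 + rtime m) base_point \<in> U1" using m(1) by (intro k1[rule_format] rtime_in_return_times) simp
    have "shift (v1 + rtime (Suc m)) base_point \<in> V1" using m(1) by (intro k2[rule_format] rtime_in_return_times) simp
    moreover have "?n + (u1 + rtime m) = v1 + rtime (Suc m)" using rm by simp
    ultimately have 2: "shift ?n (shift (u1 + rtime m) base_point) \<in> V1" by (simp only: shift_shift)
    have "shift (v2 + rtime m) base_point \<in> V2" using m(1) by (intro k3[rule_format] rtime_in_return_times) simp
    then have 3: "shift ?n (shift u2 base_point) \<in> V2" by (simp add: shift_shift algebra_simps)
    show ?thesis using n 1 2 3 uv(3) shift_base_point_in by blast
  qed
  obtain u1 v1 u2 v2 where uv: "shift u1 base_point \<in> U1" "shift v1 base_point \<in> V1"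
      "shift u2 base_point \<in> U2" "shift v2 base_point \<in> V2"
    using subshift_meets_orbit assms by (metis disjoint_iff)
  have "\<exists>n x y. n \<ge> 1 \<and> x \<in> subshift \<and> y \<in> subshift
      \<and> x \<in> U1 \<and> shift n x \<in> V1 \<and> y \<in> U2 \<and> shift n y \<in> V2"
  proof (cases "v2 - u2 \<ge> v1 - u1")
    case True
    show ?thesis by (rule wlog[OF assms(1-4) uv True])
  next
    case False
    then show ?thesis
      using wlog[OF assms(3,4,1,2) uv(3,4,1,2)] by fastforce
  qed
  then show thesis using that by blast
qed

lemma subshift_homeomorphic_cantor: "subshift homeomorphic (UNIV :: (nat \<Rightarrow> bool) set)"
proof (rule homeomorphic_cantor_set[where C = "\<lambda>n. {x. x (from_nat n)}"])
  show "subshift \<noteq> {}" using zero_in_subshift by blast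
  fix n
  have op: "open {x :: int \<Rightarrow> bool. x (from_nat n) \<in> B}" for B
    using product_topology_basis'[of "{()}" "\<lambda>_. B" "\<lambda>_. from_nat n"] by (simp add: open_discrete)
  show "openin (top_of_set subshift) (subshift \<inter> {x. x (from_nat n)})"
    using op[of "{True}"] by (intro openin_open_Int) simp
  have "subshift - {x. x (from_nat n)} = subshift \<inter> {x. x (from_nat n) \<in> {False}}" by auto
  then show "openin (top_of_set subshift) (subshift - {x. x (from_nat n)})"
    using op[of "{False}"] by (simp only: openin_open_Int)
next
  fix x y :: "int \<Rightarrow> bool" assume "x \<noteq> y"
  then obtain i where "x i \<noteq> y i" by blast
  then show "\<exists>n. (x \<in> {x. x (from_nat n)}) \<noteq> (y \<in> {x. x (from_nat n)})"
    by (intro exI[of _ "to_nat i"]) simp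
next
  fix x assume x: "x \<in> subshift"
  show "\<not> openin (top_of_set subshift) {x}"
  proof
    assume "openin (top_of_set subshift) {x}"
    then obtain U where "open U" "{x} = subshift \<inter> U" unfolding openin_open by blast
    then show False using subshift_perfect[of U x] x by blast
  qed
qed (rule compact_subshift)

section \<open>Generic homeomorphisms\<close>

text \<open>
Finite covers by small clopen sets, one for each scale \<open>1 / (n + 1)\<close>, together form a basis.
\<close>

lemma cantor_space_countable_clopen_basis:
  assumes "cantor_space TYPE('a::metric_space)"
  shows "\<exists>\<B> :: 'a set set. countable \<B> \<and> topological_basis \<B> \<and> (\<forall>C\<in>\<B>. open C \<and> closed C)"
proof -
  obtain B :: "'a set set" where B: "topological_basis B" "\<forall>C\<in>B. open C \<and> closed C"
    and comp: "compact (UNIV :: 'a set)"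
    using assms unfolding cantor_space_def by blast
  have "\<forall>n. \<exists>F. F \<subseteq> {C \<in> B. \<exists>z. C \<subseteq> ball z (1 / Suc n)} \<and> finite F \<and> UNIV \<subseteq> \<Union>F"
  proof
    fix n
    have "UNIV \<subseteq> \<Union>{C \<in> B. \<exists>z. C \<subseteq> ball z (1 / Suc n)}"
    proof
      fix x :: 'a
      obtain C where "C \<in> B" "x \<in> C" "C \<subseteq> ball x (1 / Suc n)"
        by (rule topological_basisE[OF B(1), of "ball x (1 / Suc n)" x]) auto
      then show "x \<in> \<Union>{C \<in> B. \<exists>z. C \<subseteq> ball z (1 / Suc n)}" by blast
    qed
    then obtain F where "F \<subseteq> {C \<in> B. \<exists>z. C \<subseteq> ball z (1 / Suc n)}" "finite F" "UNIV \<subseteq> \<Union>F"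
      by (rule compactE[OF comp]) (use B(2) in auto)
    then show "\<exists>F. F \<subseteq> {C \<in> B. \<exists>z. C \<subseteq> ball z (1 / Suc n)} \<and> finite F \<and> UNIV \<subseteq> \<Union>F"
      by blast
  qed
  then have "\<exists>F. \<forall>n. F n \<subseteq> {C \<in> B. \<exists>z. C \<subseteq> ball z (1 / Suc n)} \<and> finite (F n) \<and> UNIV \<subseteq> \<Union>(F n)"
    by (rule choice)
  then obtain F where F: "\<And>n. F n \<subseteq> {C \<in> B. \<exists>z. C \<subseteq> ball z (1 / Suc n)}" "\<And>n. finite (F n)"
      "\<And>n. UNIV \<subseteq> \<Union>(F n)"
    by blast
  have clopen: "open C \<and> closed C" if C: "C \<in> (\<Union>n. F n)" for C
  proof -
    obtain n where "C \<in> F n" using C by blast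
    then have "C \<in> B" using F(1)[of n] by blast
    then show ?thesis using B(2) by blast
  qed
  have "topological_basis (\<Union>n. F n)"
  proof (rule topological_basisI)
    fix C assume "C \<in> (\<Union>n. F n)" then show "open C" using clopen by blast
  next
    fix U :: "'a set" and x assume "open U" "x \<in> U"
    then obtain e where e: "e > 0" "ball x e \<subseteq> U" using open_contains_ball by blast
    obtain n where n: "1 / Suc n < e / 2" using nat_approx_posE[of "e / 2"] e(1) by auto
    obtain C where C: "C \<in> F n" "x \<in> C" using F(3)[of n] by blast
    then obtain z where z: "C \<subseteq> ball z (1 / Suc n)" using F(1)[of n] by blast
    have "C \<subseteq> ball x e"
    proof
      fix y assume "y \<in> C"
      then have "dist z y < e / 2" "dist z x < e / 2" using z C(2) n by (auto simp: subset_eq)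
      then show "y \<in> ball x e" by (metis dist_commute dist_triangle_half_l mem_ball)
    qed
    then show "\<exists>B'\<in>\<Union>n. F n. x \<in> B' \<and> B' \<subseteq> U" using C e(2) by blast
  qed
  moreover have "countable (\<Union>n. F n)" using F(2) by (simp add: countable_finite)
  moreover have "\<forall>C\<in>\<Union>n. F n. open C \<and> closed C" using clopen by blast
  ultimately show ?thesis by blast
qed

lemma clopen_homeomorphic_cantor:
  assumes cantor: "cantor_space TYPE('a::metric_space)"
    and A: "open A" "closed A" "A \<noteq> ({} :: 'a set)"
  shows "A homeomorphic (UNIV :: (nat \<Rightarrow> bool) set)"
proof -
  obtain \<B> :: "'a set set" where \<B>: "countable \<B>" "topological_basis \<B>" "\<forall>C\<in>\<B>. open C \<and> closed C"
    using cantor_space_countable_clopen_basis[OF cantor] by blast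
  obtain x :: 'a where True by blast
  have "\<B> \<noteq> {}" using topological_basisE[OF \<B>(2) open_UNIV, of x] by blast
  then have C: "from_nat_into \<B> n \<in> \<B>" for n by (rule from_nat_into)
  have onto: "\<exists>n. from_nat_into \<B> n = b" if "b \<in> \<B>" for b
    using from_nat_into_surj[OF \<B>(1) that] .
  show ?thesis
  proof (rule homeomorphic_cantor_set[where C = "from_nat_into \<B>"])
    show "compact A" using cantor A(2) compact_Int_closed[of UNIV A] unfolding cantor_space_def by simp
    show "openin (top_of_set A) (A \<inter> from_nat_into \<B> n)" for n
      using \<B>(3) C by (simp add: openin_open_Int)
    have "A - from_nat_into \<B> n = A \<inter> - from_nat_into \<B> n" for n by blast
    then show "openin (top_of_set A) (A - from_nat_into \<B> n)" for n
      using \<B>(3) C[of n] by (simp add: openin_open_Int open_Compl)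
  next
    fix x y assume "x \<in> A" "y \<in> A" "x \<noteq> y"
    then have "x \<in> - {y}" by simp
    then obtain b where "b \<in> \<B>" "x \<in> b" "b \<subseteq> - {y}"
      using topological_basisE[OF \<B>(2), of "- {y}" x] by (metis open_delete open_UNIV Compl_eq_Diff_UNIV)
    then show "\<exists>n. (x \<in> from_nat_into \<B> n) \<noteq> (y \<in> from_nat_into \<B> n)"
      using onto by blast
  next
    fix x assume "x \<in> A"
    show "\<not> openin (top_of_set A) {x}"
    proof
      assume "openin (top_of_set A) {x}"
      then have "open {x}" using A(1) openin_open_trans by blast
      then have "\<not> x islimpt UNIV" unfolding islimpt_def by blast
      then show False using cantor unfolding cantor_space_def by blast
    qed
  qed (rule A(3))
qed

text \<open>
For a homeomorphism of the whole space this is membership in \<^term>\<open>HM1u \<inter> WM\<close>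
(\<open>generic_iff\<close>). The form relative to a set \<open>K\<close>, with the inverse \<open>g\<close> named explicitly, lets
the same transport lemma move the property from the subshift to the given space and along
conjugacies of that space.
\<close>

definition generic_on :: "'b::topological_space set \<Rightarrow> ('b \<Rightarrow> 'b) \<Rightarrow> ('b \<Rightarrow> 'b) \<Rightarrow> bool" where
  "generic_on K f g \<longleftrightarrow> homeomorphism K K f g
     \<and> (\<exists>!x. x \<in> K \<and> f x = x)
     \<and> (\<forall>x\<in>K. f x \<noteq> x \<longrightarrow>
          (\<forall>U. open U \<and> U \<inter> K \<noteq> {} \<longrightarrow> (\<exists>n. (f ^^ n) x \<in> U \<or> (g ^^ n) x \<in> U)))
     \<and> (\<forall>U1 V1 U2 V2. open U1 \<and> open V1 \<and> open U2 \<and> open V2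
          \<and> U1 \<inter> K \<noteq> {} \<and> V1 \<inter> K \<noteq> {} \<and> U2 \<inter> K \<noteq> {} \<and> V2 \<inter> K \<noteq> {} \<longrightarrow>
          (\<exists>n\<ge>1. \<exists>x\<in>K \<inter> U1. \<exists>y\<in>K \<inter> U2. (f ^^ n) x \<in> V1 \<and> (f ^^ n) y \<in> V2))"

lemma generic_onD:
  assumes "generic_on K f g"
  shows "homeomorphism K K f g"
    and "\<exists>!x. x \<in> K \<and> f x = x"
    and "\<And>x U. x \<in> K \<Longrightarrow> f x \<noteq> x \<Longrightarrow> open U \<Longrightarrow> U \<inter> K \<noteq> {} \<Longrightarrow>
           \<exists>n. (f ^^ n) x \<in> U \<or> (g ^^ n) x \<in> U"
    and "\<And>U1 V1 U2 V2. open U1 \<Longrightarrow> open V1 \<Longrightarrow> open U2 \<Longrightarrow> open V2 \<Longrightarrow>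
           U1 \<inter> K \<noteq> {} \<Longrightarrow> V1 \<inter> K \<noteq> {} \<Longrightarrow> U2 \<inter> K \<noteq> {} \<Longrightarrow> V2 \<inter> K \<noteq> {} \<Longrightarrow>
           \<exists>n\<ge>1. \<exists>x\<in>K \<inter> U1. \<exists>y\<in>K \<inter> U2. (f ^^ n) x \<in> V1 \<and> (f ^^ n) y \<in> V2"
  using assms[unfolded generic_on_def] by simp_all

lemma funpow_shift: "(shift d ^^ n) x = shift (int n * d) x"
  by (induction n) (simp_all add: shift_shift algebra_simps)

lemma generic_on_subshift: "generic_on subshift (shift 1) (shift (- 1))"
  unfolding generic_on_def
proof (intro conjI)
  show "homeomorphism subshift subshift (shift 1) (shift (- 1))"
    by (rule homeomorphismI) (auto simp: continuous_shift shift_shift shift_in_subshift)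
  show "\<exists>!x. x \<in> subshift \<and> shift 1 x = x"
    using subshift_fixed_iff zero_in_subshift by metis
  show "\<forall>x\<in>subshift. shift 1 x \<noteq> x \<longrightarrow>
      (\<forall>U. open U \<and> U \<inter> subshift \<noteq> {} \<longrightarrow>
        (\<exists>n. (shift 1 ^^ n) x \<in> U \<or> (shift (- 1) ^^ n) x \<in> U))"
  proof (intro ballI allI impI, elim conjE)
    fix x and U :: "(int \<Rightarrow> bool) set"
    assume "x \<in> subshift" "shift 1 x \<noteq> x" "open U" "U \<inter> subshift \<noteq> {}"
    then obtain m where m: "shift m x \<in> U" using subshift_orbit_dense subshift_fixed_iff by metis
    show "\<exists>n. (shift 1 ^^ n) x \<in> U \<or> (shift (- 1) ^^ n) x \<in> U"
      using m by (intro exI[of _ "nat \<bar>m\<bar>"]) (auto simp: funpow_shift abs_if split: if_splits)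
  qed
  show "\<forall>U1 V1 U2 V2. open U1 \<and> open V1 \<and> open U2 \<and> open V2
      \<and> U1 \<inter> subshift \<noteq> {} \<and> V1 \<inter> subshift \<noteq> {} \<and> U2 \<inter> subshift \<noteq> {} \<and> V2 \<inter> subshift \<noteq> {} \<longrightarrow>
      (\<exists>n\<ge>1. \<exists>x\<in>subshift \<inter> U1. \<exists>y\<in>subshift \<inter> U2.
         (shift 1 ^^ n) x \<in> V1 \<and> (shift 1 ^^ n) y \<in> V2)"
  proof (intro allI impI, elim conjE)
    fix U1 V1 U2 V2 :: "(int \<Rightarrow> bool) set"
    assume "open U1" "open V1" "open U2" "open V2" "U1 \<inter> subshift \<noteq> {}" "V1 \<inter> subshift \<noteq> {}"
      "U2 \<inter> subshift \<noteq> {}" "V2 \<inter> subshift \<noteq> {}"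
    then obtain n x y where "n \<ge> 1" "x \<in> subshift" "y \<in> subshift"
      "x \<in> U1" "shift n x \<in> V1" "y \<in> U2" "shift n y \<in> V2"
      by (rule subshift_weak_mixing)
    then show "\<exists>n\<ge>1. \<exists>x\<in>subshift \<inter> U1. \<exists>y\<in>subshift \<inter> U2.
         (shift 1 ^^ n) x \<in> V1 \<and> (shift 1 ^^ n) y \<in> V2"
      by (intro exI[of _ "nat n"] conjI bexI[of _ x] bexI[of _ y]) (auto simp: funpow_shift)
  qed
qed

lemma generic_on_transfer:
  fixes k :: "'a::topological_space \<Rightarrow> 'b::topological_space"
  assumes gen: "generic_on K f g" and hom: "homeomorphism L K k k'"
  shows "generic_on L (k' \<circ> f \<circ> k) (k' \<circ> g \<circ> k)"
proof -
  have fg: "homeomorphism K K f g" by (rule generic_onD(1)[OF gen])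
  have k: "\<And>x. x \<in> L \<Longrightarrow> k x \<in> K" "\<And>w. w \<in> K \<Longrightarrow> k' w \<in> L"
    "\<And>x. x \<in> L \<Longrightarrow> k' (k x) = x" "\<And>w. w \<in> K \<Longrightarrow> k (k' w) = w"
    using hom unfolding homeomorphism_def by auto
  have f: "\<And>w. w \<in> K \<Longrightarrow> f w \<in> K" "\<And>w. w \<in> K \<Longrightarrow> g w \<in> K"
    using fg unfolding homeomorphism_def by auto
  have pow: "(p ^^ n) w \<in> K" "((k' \<circ> p \<circ> k) ^^ n) (k' w) = k' ((p ^^ n) w)"
    if "w \<in> K" "\<And>w. w \<in> K \<Longrightarrow> p w \<in> K" for p n w
    by (induction n) (use that k in auto)
  have pull: "\<exists>V. open V \<and> (\<forall>w\<in>K. w \<in> V \<longleftrightarrow> k' w \<in> U)" if U: "open U" for U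
  proof -
    have "continuous_on K k'" using hom unfolding homeomorphism_def by blast
    then obtain V where "open V" "V \<inter> K = k' -` U \<inter> K"
      using U unfolding continuous_on_open_invariant by blast
    then show ?thesis by (intro exI[of _ V]) auto
  qed
  have meets: "V \<inter> K \<noteq> {}" if V: "\<forall>w\<in>K. w \<in> V \<longleftrightarrow> k' w \<in> U" and U: "U \<inter> L \<noteq> {}" for U V
  proof -
    obtain x where "x \<in> U" "x \<in> L" using U by blast
    then have "k x \<in> V \<inter> K" using V k by simp
    then show ?thesis by blast
  qed
  show ?thesis
    unfolding generic_on_def
  proof (intro conjI)
    show "homeomorphism L L (k' \<circ> f \<circ> k) (k' \<circ> g \<circ> k)"
      using homeomorphism_compose[OF homeomorphism_compose[OF hom fg] homeomorphism_symD[OF hom]]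
      by (simp add: o_assoc)
    obtain e where e: "e \<in> K \<and> f e = e" "\<forall>w. w \<in> K \<and> f w = w \<longrightarrow> w = e"
      by (rule ex1E[OF generic_onD(2)[OF gen]])
    show "\<exists>!x. x \<in> L \<and> (k' \<circ> f \<circ> k) x = x"
    proof (rule ex1I[of _ "k' e"])
      show "k' e \<in> L \<and> (k' \<circ> f \<circ> k) (k' e) = k' e" using e(1) k by simp
      fix x assume x: "x \<in> L \<and> (k' \<circ> f \<circ> k) x = x"
      then have "k (k' (f (k x))) = k x" by simp
      then have "f (k x) = k x" using k f x by simp
      then have "k x = e" using e(2) k x by blast
      then show "x = k' e" using x k by auto
    qed
    show "\<forall>x\<in>L. (k' \<circ> f \<circ> k) x \<noteq> x \<longrightarrow> (\<forall>U. open U \<and> U \<inter> L \<noteq> {} \<longrightarrow>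
        (\<exists>n. ((k' \<circ> f \<circ> k) ^^ n) x \<in> U \<or> ((k' \<circ> g \<circ> k) ^^ n) x \<in> U))"
    proof (intro ballI allI impI, elim conjE)
      fix x U assume x: "x \<in> L" "(k' \<circ> f \<circ> k) x \<noteq> x" and U: "open U" "U \<inter> L \<noteq> {}"
      obtain V where V: "open V" "\<forall>w\<in>K. w \<in> V \<longleftrightarrow> k' w \<in> U" using pull[OF U(1)] by blast
      have "f (k x) \<noteq> k x" using x k by auto
      then obtain n where n: "(f ^^ n) (k x) \<in> V \<or> (g ^^ n) (k x) \<in> V"
        using generic_onD(3)[OF gen k(1)[OF x(1)] _ V(1) meets[OF V(2) U(2)]] by blast
      have "k' (k x) = x" using x k by simp
      then show "\<exists>n. ((k' \<circ> f \<circ> k) ^^ n) x \<in> U \<or> ((k' \<circ> g \<circ> k) ^^ n) x \<in> U"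
        using n V(2) pow[OF k(1)[OF x(1)], of f n] pow[OF k(1)[OF x(1)], of g n] f by metis
    qed
    show "\<forall>U1 V1 U2 V2. open U1 \<and> open V1 \<and> open U2 \<and> open V2
        \<and> U1 \<inter> L \<noteq> {} \<and> V1 \<inter> L \<noteq> {} \<and> U2 \<inter> L \<noteq> {} \<and> V2 \<inter> L \<noteq> {} \<longrightarrow>
        (\<exists>n\<ge>1. \<exists>x\<in>L \<inter> U1. \<exists>y\<in>L \<inter> U2.
           ((k' \<circ> f \<circ> k) ^^ n) x \<in> V1 \<and> ((k' \<circ> f \<circ> k) ^^ n) y \<in> V2)"
    proof (intro allI impI, elim conjE)
      fix U1 V1 U2 V2 :: "'a set"
      assume op: "open U1" "open V1" "open U2" "open V2"
        and ne: "U1 \<inter> L \<noteq> {}" "V1 \<inter> L \<noteq> {}" "U2 \<inter> L \<noteq> {}" "V2 \<inter> L \<noteq> {}"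
      obtain A1 where A1: "open A1" "\<forall>w\<in>K. w \<in> A1 \<longleftrightarrow> k' w \<in> U1" using pull[OF op(1)] by blast
      obtain B1 where B1: "open B1" "\<forall>w\<in>K. w \<in> B1 \<longleftrightarrow> k' w \<in> V1" using pull[OF op(2)] by blast
      obtain A2 where A2: "open A2" "\<forall>w\<in>K. w \<in> A2 \<longleftrightarrow> k' w \<in> U2" using pull[OF op(3)] by blast
      obtain B2 where B2: "open B2" "\<forall>w\<in>K. w \<in> B2 \<longleftrightarrow> k' w \<in> V2" using pull[OF op(4)] by blast
      obtain n v w where n: "n \<ge> 1" "v \<in> K \<inter> A1" "w \<in> K \<inter> A2" "(f ^^ n) v \<in> B1" "(f ^^ n) w \<in> B2"
        using generic_onD(4)[OF gen A1(1) B1(1) A2(1) B2(1) meets[OF A1(2) ne(1)]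
            meets[OF B1(2) ne(2)] meets[OF A2(2) ne(3)] meets[OF B2(2) ne(4)]] by blast
      then have "k' v \<in> L \<inter> U1" "k' w \<in> L \<inter> U2" using A1 A2 k by auto
      moreover have "((k' \<circ> f \<circ> k) ^^ n) (k' v) \<in> V1" "((k' \<circ> f \<circ> k) ^^ n) (k' w) \<in> V2"
        using n B1(2) B2(2) pow[of v f n] pow[of w f n] f by auto
      ultimately show "\<exists>n\<ge>1. \<exists>x\<in>L \<inter> U1. \<exists>y\<in>L \<inter> U2.
           ((k' \<circ> f \<circ> k) ^^ n) x \<in> V1 \<and> ((k' \<circ> f \<circ> k) ^^ n) y \<in> V2"
        using n(1) by blast
    qed
  qed
qed

lemma homeomorphism_inv_eq: "homeomorphism UNIV UNIV f g \<Longrightarrow> inv f = g"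
  unfolding homeomorphism_def by (intro inv_equality) auto

lemma closure_eq_UNIV_iff:
  "closure S = UNIV \<longleftrightarrow> (\<forall>U. open U \<and> U \<noteq> {} \<longrightarrow> U \<inter> S \<noteq> {})"
proof
  assume "closure S = UNIV"
  then show "\<forall>U. open U \<and> U \<noteq> {} \<longrightarrow> U \<inter> S \<noteq> {}"
    using open_Int_closure_eq_empty by (metis Int_UNIV_right)
next
  assume *: "\<forall>U. open U \<and> U \<noteq> {} \<longrightarrow> U \<inter> S \<noteq> {}"
  have "- closure S \<inter> S = {}" using closure_subset by blast
  then have "- closure S = {}" using * open_Compl[OF closed_closure] by blast
  then show "closure S = UNIV" by blast
qed

lemma funpow_map_prod:
  fixes f :: "'a \<Rightarrow> 'a" and g :: "'b \<Rightarrow> 'b"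
  shows "map_prod f g ^^ n = map_prod (f ^^ n) (g ^^ n)"
  by (induction n) (auto simp: fun_eq_iff)

lemma transitive_map_prod_iff:
  "topologically_transitive (map_prod f f) \<longleftrightarrow>
    (\<forall>U1 V1 U2 V2. open U1 \<and> open V1 \<and> open U2 \<and> open V2
       \<and> U1 \<noteq> {} \<and> V1 \<noteq> {} \<and> U2 \<noteq> {} \<and> V2 \<noteq> {} \<longrightarrow>
       (\<exists>n\<ge>1. \<exists>x\<in>U1. \<exists>y\<in>U2. (f ^^ n) x \<in> V1 \<and> (f ^^ n) y \<in> V2))" (is "?L \<longleftrightarrow> ?R")
proof
  assume L: ?L
  show ?R
  proof (intro allI impI, elim conjE)
    fix U1 V1 U2 V2 :: "'a set"
    assume *: "open U1" "open V1" "open U2" "open V2" "U1 \<noteq> {}" "V1 \<noteq> {}" "U2 \<noteq> {}" "V2 \<noteq> {}"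
    have "open (U1 \<times> U2)" "open (V1 \<times> V2)" "U1 \<times> U2 \<noteq> {}" "V1 \<times> V2 \<noteq> {}"
      using * by (auto intro: open_Times)
    then have "\<exists>n\<ge>1. (map_prod f f ^^ n) ` (U1 \<times> U2) \<inter> (V1 \<times> V2) \<noteq> {}"
      by (intro L[unfolded topologically_transitive_def, rule_format] conjI)
    then obtain n where "n \<ge> 1" "(map_prod f f ^^ n) ` (U1 \<times> U2) \<inter> (V1 \<times> V2) \<noteq> {}"
      by (elim exE conjE)
    then show "\<exists>n\<ge>1. \<exists>x\<in>U1. \<exists>y\<in>U2. (f ^^ n) x \<in> V1 \<and> (f ^^ n) y \<in> V2"
      by (intro exI[of _ n]) (auto simp: funpow_map_prod)
  qed
next
  assume R: ?R
  show ?L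
    unfolding topologically_transitive_def
  proof (intro allI impI, elim conjE)
    fix U V :: "('a \<times> 'a) set"
    assume *: "open U" "open V" "U \<noteq> {}" "V \<noteq> {}"
    obtain u v where "u \<in> U" "v \<in> V" using * by blast
    obtain U1 U2 where U: "open U1" "open U2" "u \<in> U1 \<times> U2" "U1 \<times> U2 \<subseteq> U"
      using open_prod_elim[OF *(1) \<open>u \<in> U\<close>] .
    obtain V1 V2 where V: "open V1" "open V2" "v \<in> V1 \<times> V2" "V1 \<times> V2 \<subseteq> V"
      using open_prod_elim[OF *(2) \<open>v \<in> V\<close>] .
    have "U1 \<noteq> {}" "U2 \<noteq> {}" "V1 \<noteq> {}" "V2 \<noteq> {}" using U V by auto
    then have "\<exists>n\<ge>1. \<exists>x\<in>U1. \<exists>y\<in>U2. (f ^^ n) x \<in> V1 \<and> (f ^^ n) y \<in> V2"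
      by (intro R[rule_format] conjI U V)
    then obtain n x y where n: "n \<ge> 1" "x \<in> U1" "y \<in> U2" "(f ^^ n) x \<in> V1" "(f ^^ n) y \<in> V2"
      by (elim exE bexE conjE)
    then have "(map_prod f f ^^ n) (x, y) \<in> V" "(x, y) \<in> U" using U V by (auto simp: funpow_map_prod)
    then show "\<exists>n\<ge>1. (map_prod f f ^^ n) ` U \<inter> V \<noteq> {}" using n(1) by blast
  qed
qed

lemma generic_iff:
  fixes f :: "'a::metric_space \<Rightarrow>\<^sub>C 'a"
  shows "f \<in> HM1u \<inter> WM \<longleftrightarrow> (\<exists>g. generic_on UNIV (apply_bcontfun f) g)"
proof -
  let ?f = "apply_bcontfun f"
  have orbit: "closure (range (\<lambda>i. iterate ?f i x)) = UNIV \<longleftrightarrow>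
      (\<forall>U. open U \<and> U \<noteq> {} \<longrightarrow> (\<exists>n. (?f ^^ n) x \<in> U \<or> (g ^^ n) x \<in> U))"
    if "homeomorphism UNIV UNIV ?f g" for g x
  proof -
    have inv: "inv ?f = g" by (rule homeomorphism_inv_eq[OF that])
    have "(\<exists>i. iterate ?f i x \<in> U) \<longleftrightarrow> (\<exists>n. (?f ^^ n) x \<in> U \<or> (g ^^ n) x \<in> U)" for U
    proof
      assume "\<exists>i. iterate ?f i x \<in> U"
      then show "\<exists>n. (?f ^^ n) x \<in> U \<or> (g ^^ n) x \<in> U"
        unfolding iterate_def inv by (metis (full_types))
    next
      assume "\<exists>n. (?f ^^ n) x \<in> U \<or> (g ^^ n) x \<in> U"
      then obtain n where "(?f ^^ n) x \<in> U \<or> (g ^^ n) x \<in> U" by blast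
      moreover have "iterate ?f (int n) x = (?f ^^ n) x" by (simp add: iterate_def)
      moreover have "iterate ?f (- int n) x = (g ^^ n) x"
        by (cases "n = 0") (simp_all add: iterate_def inv)
      ultimately show "\<exists>i. iterate ?f i x \<in> U" by metis
    qed
    then show ?thesis unfolding closure_eq_UNIV_iff by blast
  qed
  show ?thesis
  proof
    assume f: "f \<in> HM1u \<inter> WM"
    then obtain g where g: "homeomorphism UNIV UNIV ?f g" unfolding HM1u_def homeos_def by blast
    have "generic_on UNIV ?f g"
      using f g unfolding generic_on_def HM1u_def WM_def transitive_map_prod_iff
      by (simp add: orbit[OF g])
    then show "\<exists>g. generic_on UNIV ?f g" by blast
  next
    assume "\<exists>g. generic_on UNIV ?f g"
    then obtain g where g: "generic_on UNIV ?f g" ..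
    then have hom: "homeomorphism UNIV UNIV ?f g" by (rule generic_onD(1))
    then have "f \<in> cont_surj" unfolding homeomorphism_def cont_surj_def by blast
    moreover have "f \<in> homeos" using hom unfolding homeos_def by blast
    ultimately show "f \<in> HM1u \<inter> WM"
      using g unfolding generic_on_def HM1u_def WM_def transitive_map_prod_iff
      by (simp add: orbit[OF hom])
  qed
qed

lemma generic_exists:
  assumes "cantor_space TYPE('a::metric_space)"
  shows "\<exists>f :: 'a \<Rightarrow>\<^sub>C 'a. f \<in> HM1u \<inter> WM"
proof -
  have comp: "compact (UNIV :: 'a set)" using assms unfolding cantor_space_def by blast
  have "(UNIV :: 'a set) homeomorphic subshift"
    using clopen_homeomorphic_cantor[OF assms, of UNIV] subshift_homeomorphic_cantor
    using homeomorphic_trans homeomorphic_sym by blast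
  then obtain k k' where "homeomorphism (UNIV :: 'a set) subshift k k'"
    unfolding homeomorphic_def by blast
  then have gen: "generic_on UNIV (k' \<circ> shift 1 \<circ> k) (k' \<circ> shift (- 1) \<circ> k)"
    by (rule generic_on_transfer[OF generic_on_subshift])
  then have "continuous_on UNIV (k' \<circ> shift 1 \<circ> k)"
    using generic_onD(1) homeomorphism_def by blast
  then obtain f :: "'a \<Rightarrow>\<^sub>C 'a" where "apply_bcontfun f = k' \<circ> shift 1 \<circ> k"
    using compact_continuous_is_bcontfun[OF comp] by blast
  then show ?thesis using gen generic_iff by metis
qed

lemma generic_conj:
  assumes "compact (UNIV :: 'a::metric_space set)" "f \<in> HM1u \<inter> WM"
  shows "conj_class (f :: 'a \<Rightarrow>\<^sub>C 'a) \<subseteq> HM1u \<inter> WM"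
proof
  fix F assume "F \<in> conj_class f"
  then obtain h where h: "h \<in> homeos" and
    F: "apply_bcontfun F = apply_bcontfun h \<circ> apply_bcontfun f \<circ> inv (apply_bcontfun h)"
    unfolding conj_class_def by blast
  obtain k where k: "homeomorphism UNIV UNIV (apply_bcontfun h) k" using h unfolding homeos_def by blast
  obtain g where g: "generic_on UNIV (apply_bcontfun f) g" using assms(2) generic_iff by blast
  have "generic_on UNIV (apply_bcontfun h \<circ> apply_bcontfun f \<circ> k) (apply_bcontfun h \<circ> g \<circ> k)"
    by (rule generic_on_transfer[OF g homeomorphism_symD[OF k]])
  then show "F \<in> HM1u \<inter> WM" using generic_iff[of F] F homeomorphism_inv_eq[OF k] by auto
qed

section \<open>Chain mixing maps with a fixed point\<close>

definition chain_step :: "real \<Rightarrow> ('a::metric_space \<Rightarrow> 'a) \<Rightarrow> ('a \<times> 'a) set" where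
  "chain_step \<epsilon> f = V_rel \<epsilon> O fun_rel f O V_rel \<epsilon>"

lemma chain_step_iff: "(x, y) \<in> chain_step \<epsilon> f \<longleftrightarrow> (\<exists>z. dist x z < \<epsilon> \<and> dist (f z) y < \<epsilon>)"
  unfolding chain_step_def V_rel_def fun_rel_def by auto

lemma chain_mixing_iff: "chain_mixing f \<longleftrightarrow> (\<forall>\<epsilon>>0. \<exists>N\<ge>1. \<forall>x y. (x, y) \<in> chain_step \<epsilon> f ^^ N)"
  unfolding chain_mixing_def chain_step_def by (simp add: set_eq_iff split_paired_All)

lemma relpow_map:
  assumes "\<And>x y. (x, y) \<in> R \<Longrightarrow> (h x, h y) \<in> R'" and "(x, y) \<in> R ^^ n"
  shows "(h x, h y) \<in> R' ^^ n"
  using assms(2)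
proof (induction n arbitrary: y)
  case (Suc n)
  then obtain z where "(x, z) \<in> R ^^ n" "(z, y) \<in> R" by auto
  then show ?case using Suc.IH assms(1) by (meson relpow_Suc_I)
qed simp

text \<open>
By uniform continuity \<open>h\<close> maps \<open>\<delta>\<close>-chains to \<open>\<epsilon>\<close>-chains.
\<close>

lemma chain_mixing_conj:
  fixes f h k :: "'a::metric_space \<Rightarrow> 'a"
  assumes "compact (UNIV :: 'a set)" and hom: "homeomorphism UNIV UNIV h k" and f: "chain_mixing f"
  shows "chain_mixing (h \<circ> f \<circ> k)"
  unfolding chain_mixing_iff
proof (intro allI impI)
  fix \<epsilon> :: real assume "\<epsilon> > 0"
  have hk: "h (k y) = y" "k (h y) = y" "continuous_on UNIV h" for y
    using hom unfolding homeomorphism_def by auto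
  obtain \<delta> where \<delta>: "\<delta> > 0" "\<And>x y. dist x y < \<delta> \<Longrightarrow> dist (h x) (h y) < \<epsilon>"
    using compact_uniformly_continuous[OF hk(3) assms(1)] \<open>\<epsilon> > 0\<close>
    unfolding uniformly_continuous_on_def by (metis UNIV_I)
  obtain N where N: "N \<ge> 1" "\<And>x y. (x, y) \<in> chain_step \<delta> f ^^ N"
    using f \<delta>(1) unfolding chain_mixing_iff by meson
  have step: "(h x, h y) \<in> chain_step \<epsilon> (h \<circ> f \<circ> k)" if xy: "(x, y) \<in> chain_step \<delta> f" for x y
  proof -
    obtain z where "dist x z < \<delta>" "dist (f z) y < \<delta>" using xy unfolding chain_step_iff by blast
    then show ?thesis unfolding chain_step_iff
      using \<delta>(2) hk(2) by (intro exI[of _ "h z"]) simp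
  qed
  have "(x, y) \<in> chain_step \<epsilon> (h \<circ> f \<circ> k) ^^ N" for x y
    using relpow_map[of "chain_step \<delta> f" h, OF step N(2)[of "k x" "k y"]] hk(1) by simp
  then show "\<exists>N\<ge>1. \<forall>x y. (x, y) \<in> chain_step \<epsilon> (h \<circ> f \<circ> k) ^^ N" using N(1) by blast
qed

lemma conj_class_CM1:
  assumes "compact (UNIV :: 'a::metric_space set)" and f: "f \<in> (CM1 :: ('a \<Rightarrow>\<^sub>C 'a) set)"
  shows "conj_class f \<subseteq> CM1"
proof
  fix F assume "F \<in> conj_class f"
  then obtain h where h: "h \<in> homeos" and
    F: "apply_bcontfun F = apply_bcontfun h \<circ> apply_bcontfun f \<circ> inv (apply_bcontfun h)"
    unfolding conj_class_def by blast
  obtain k where hom: "homeomorphism UNIV UNIV (apply_bcontfun h) k" using h unfolding homeos_def by blast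
  have F: "apply_bcontfun F = apply_bcontfun h \<circ> apply_bcontfun f \<circ> k"
    using F homeomorphism_inv_eq[OF hom] by simp
  have hk: "\<And>y. k (apply_bcontfun h y) = y" "surj (apply_bcontfun h)" "surj k"
    using hom unfolding homeomorphism_def by auto
  obtain e where "apply_bcontfun f e = e" using f unfolding CM1_def by blast
  then have "apply_bcontfun F (apply_bcontfun h e) = apply_bcontfun h e" using F hk(1) by simp
  moreover have "surj (apply_bcontfun F)"
    unfolding F using hk f unfolding CM1_def cont_surj_def by (intro comp_surj) auto
  moreover have "chain_mixing (apply_bcontfun F)"
    unfolding F using f unfolding CM1_def by (intro chain_mixing_conj[OF assms(1) hom]) simp
  ultimately show "F \<in> CM1" unfolding CM1_def cont_surj_def by blast
qed

text \<open>
If \<open>g\<close> is within \<open>\<epsilon> / 2\<close> of \<open>f\<close>, then \<open>\<epsilon> / 2\<close>-chains of \<open>g\<close> are \<open>\<epsilon>\<close>-chains of \<open>f\<close>. A limit of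
maps with fixed points moves some point by an arbitrarily small amount, and the least displacement is
attained.
\<close>

lemma closed_chain_mixing_fixed:
  assumes comp: "compact (UNIV :: 'a::metric_space set)"
  shows "closed {f :: 'a \<Rightarrow>\<^sub>C 'a. chain_mixing (apply_bcontfun f) \<and> (\<exists>x. apply_bcontfun f x = x)}"
    (is "closed ?S")
proof -
  have "f \<in> ?S" if "f \<in> closure ?S" for f
  proof -
    have approx: "\<exists>g\<in>?S. dist g f < e" if "e > 0" for e
      using \<open>f \<in> closure ?S\<close> that unfolding closure_approachable by blast
    have "chain_mixing (apply_bcontfun f)"
      unfolding chain_mixing_iff
    proof (intro allI impI)
      fix \<epsilon> :: real assume \<epsilon>: "\<epsilon> > 0"
      then obtain g where g: "g \<in> ?S" "dist g f < \<epsilon> / 2" using approx[of "\<epsilon> / 2"] by auto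
      obtain N where N: "N \<ge> 1" "\<And>x y. (x, y) \<in> chain_step (\<epsilon> / 2) (apply_bcontfun g) ^^ N"
        using g(1) \<epsilon> unfolding chain_mixing_iff mem_Collect_eq by (meson half_gt_zero)
      have step: "(id x, id y) \<in> chain_step \<epsilon> (apply_bcontfun f)"
        if xy: "(x, y) \<in> chain_step (\<epsilon> / 2) (apply_bcontfun g)" for x y
      proof -
        obtain z where z: "dist x z < \<epsilon> / 2" "dist (apply_bcontfun g z) y < \<epsilon> / 2"
          using xy unfolding chain_step_iff by blast
        have "dist (apply_bcontfun f z) (apply_bcontfun g z) < \<epsilon> / 2"
          using dist_fun_lt_imp_dist_val_lt[OF g(2)] by (simp add: dist_commute)
        then have "dist (apply_bcontfun f z) y < \<epsilon>"
          using z(2) dist_triangle[of "apply_bcontfun f z" y "apply_bcontfun g z"] by simp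
        then show ?thesis unfolding chain_step_iff using z(1) \<epsilon> by (intro exI[of _ z]) simp
      qed
      have "(x, y) \<in> chain_step \<epsilon> (apply_bcontfun f) ^^ N" for x y
        using relpow_map[of "chain_step (\<epsilon> / 2) (apply_bcontfun g)" id, OF step N(2)[of x y]] by simp
      then show "\<exists>N\<ge>1. \<forall>x y. (x, y) \<in> chain_step \<epsilon> (apply_bcontfun f) ^^ N" using N(1) by blast
    qed
    moreover have "\<exists>x. apply_bcontfun f x = x"
    proof -
      have "continuous_on UNIV (\<lambda>x. dist x (apply_bcontfun f x))"
        by (intro continuous_on_dist continuous_on_id) simp
      then obtain x where x: "\<And>y. dist x (apply_bcontfun f x) \<le> dist y (apply_bcontfun f y)"
        using continuous_attains_inf[OF comp, of "\<lambda>x. dist x (apply_bcontfun f x)"] by auto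
      have "dist x (apply_bcontfun f x) \<le> e" if e: "e > 0" for e
      proof -
        obtain g where g: "g \<in> ?S" "dist g f < e" using approx[OF e] by blast
        then obtain y where y: "apply_bcontfun g y = y" by blast
        have "dist x (apply_bcontfun f x) \<le> dist y (apply_bcontfun f y)" by (rule x)
        also have "\<dots> < e" using dist_fun_lt_imp_dist_val_lt[OF g(2), of y] y by simp
        finally show ?thesis by simp
      qed
      then have "dist x (apply_bcontfun f x) \<le> 0" by (rule field_le_epsilon[of _ 0, simplified])
      then have "apply_bcontfun f x = x" by simp
      then show ?thesis ..
    qed
    ultimately show ?thesis by blast
  qed
  then have "closure ?S \<subseteq> ?S" by (rule subsetI)
  then show ?thesis by (simp only: closure_subset_eq)
qed

lemma closedin_CM1:
  assumes "compact (UNIV :: 'a::metric_space set)"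
  shows "closedin (top_of_set cont_surj) (CM1 :: ('a \<Rightarrow>\<^sub>C 'a) set)"
proof -
  have eq: "CM1 = cont_surj \<inter> {f :: 'a \<Rightarrow>\<^sub>C 'a. chain_mixing (apply_bcontfun f) \<and> (\<exists>x. apply_bcontfun f x = x)}"
    unfolding CM1_def by blast
  show ?thesis unfolding eq by (rule closedin_closed_Int[OF closed_chain_mixing_fixed[OF assms]])
qed

lemma orbit_is_chain:
  assumes "dist x u < \<epsilon>" "n \<ge> 1" "dist ((f ^^ n) u) y < \<epsilon>" "\<epsilon> > 0"
  shows "(x, y) \<in> chain_step \<epsilon> f ^^ n"
  using assms(1-3)
proof (induction n arbitrary: x u)
  case (Suc n)
  show ?case
  proof (cases "n = 0")
    case True
    then show ?thesis using Suc.prems by (auto simp: chain_step_iff)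
  next
    case False
    have "(x, f u) \<in> chain_step \<epsilon> f"
      unfolding chain_step_iff using Suc.prems(1) assms(4) by (intro exI[of _ u]) simp
    moreover have "(f u, y) \<in> chain_step \<epsilon> f ^^ n"
      using Suc.prems(3) False assms(4) by (intro Suc.IH[of _ "f u"]) (simp_all add: funpow_swap1)
    ultimately show ?thesis by (rule relpow_Suc_I2)
  qed
qed simp

text \<open>
Transitivity gives chains from any point to \<open>e\<close> and from \<open>e\<close> to any point, with finitely many lengths
by compactness. Waiting at \<open>e\<close> makes all these lengths equal.
\<close>

lemma transitive_fixed_imp_chain_mixing:
  fixes f :: "'a::metric_space \<Rightarrow> 'a"
  assumes comp: "compact (UNIV :: 'a set)" and trans: "topologically_transitive f" and e: "f e = e"
  shows "chain_mixing f"
  unfolding chain_mixing_iff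
proof (intro allI impI)
  fix \<epsilon> :: real assume \<epsilon>: "\<epsilon> > 0"
  let ?R = "chain_step \<epsilon> f"
  have "(e, e) \<in> ?R" unfolding chain_step_iff using e \<epsilon> by (intro exI[of _ e]) simp
  then have wait: "(e, e) \<in> ?R ^^ n" for n
    by (induction n) (auto intro: relpow_Suc_I)
  have "UNIV \<subseteq> (\<Union>c\<in>UNIV. ball (c :: 'a) (\<epsilon> / 2))" using \<epsilon> by auto
  then obtain C where C: "finite C" "UNIV \<subseteq> (\<Union>c\<in>C. ball (c :: 'a) (\<epsilon> / 2))"
    by (rule compactE_image[OF comp open_ball])
  have hit: "\<exists>n\<ge>1. \<exists>u\<in>U. (f ^^ n) u \<in> V" if "open U" "open V" "U \<noteq> {}" "V \<noteq> {}" for U V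
  proof -
    have "\<exists>n\<ge>1. (f ^^ n) ` U \<inter> V \<noteq> {}"
      by (rule trans[unfolded topologically_transitive_def, rule_format]) (simp add: that)
    then show ?thesis by blast
  qed
  have "\<exists>n\<ge>1. \<exists>u\<in>ball c (\<epsilon> / 2). (f ^^ n) u \<in> ball e \<epsilon>" for c
    using \<epsilon> by (intro hit) auto
  then obtain to u where to: "\<And>c. to c \<ge> 1" "\<And>c. u c \<in> ball c (\<epsilon> / 2)" "\<And>c. (f ^^ to c) (u c) \<in> ball e \<epsilon>"
    by metis
  have "\<exists>n\<ge>1. \<exists>v\<in>ball e \<epsilon>. (f ^^ n) v \<in> ball c (\<epsilon> / 2)" for c
    using \<epsilon> by (intro hit) auto
  then obtain fro v where fro: "\<And>c. fro c \<ge> 1" "\<And>c. v c \<in> ball e \<epsilon>" "\<And>c. (f ^^ fro c) (v c) \<in> ball c (\<epsilon> / 2)"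
    by metis
  have in_half: "dist x y < \<epsilon>" if "x \<in> ball c (\<epsilon> / 2)" "y \<in> ball c (\<epsilon> / 2)" for x y c :: 'a
    using dist_triangle_half_r[of c x \<epsilon> y] that by simp
  let ?m = "\<Sum>c\<in>C. to c" and ?n = "\<Sum>c\<in>C. fro c"
  have 1: "(x, e) \<in> ?R ^^ ?m" for x
  proof -
    obtain c where c: "c \<in> C" "x \<in> ball c (\<epsilon> / 2)" using C(2) by blast
    have "(x, e) \<in> ?R ^^ to c"
      using in_half[OF c(2) to(2)] to(1,3)[of c] \<epsilon> by (intro orbit_is_chain) (simp_all add: dist_commute)
    then have "(x, e) \<in> ?R ^^ (to c + (?m - to c))" using wait by (rule relpow_trans)
    moreover have "to c \<le> ?m" using c(1) C(1) by (simp add: member_le_sum)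
    ultimately show ?thesis by simp
  qed
  have 2: "(e, y) \<in> ?R ^^ ?n" for y
  proof -
    obtain c where c: "c \<in> C" "y \<in> ball c (\<epsilon> / 2)" using C(2) by blast
    have "(e, y) \<in> ?R ^^ fro c"
      using in_half[OF fro(3) c(2)] fro(1,2)[of c] \<epsilon> by (intro orbit_is_chain) simp_all
    with wait have "(e, y) \<in> ?R ^^ ((?n - fro c) + fro c)" by (rule relpow_trans)
    moreover have "fro c \<le> ?n" using c(1) C(1) by (simp add: member_le_sum)
    ultimately show ?thesis by simp
  qed
  have "(x, y) \<in> ?R ^^ (?m + (1 + ?n))" for x y
    using relpow_trans[OF 1 relpow_trans[OF wait[of 1] 2]] .
  then show "\<exists>N\<ge>1. \<forall>x y. (x, y) \<in> ?R ^^ N" by (intro exI[of _ "?m + (1 + ?n)"]) simp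
qed

lemma weak_mixing_imp_transitive:
  assumes "topologically_transitive (map_prod f f)"
  shows "topologically_transitive f"
  unfolding topologically_transitive_def
proof (intro allI impI, elim conjE)
  fix U V :: "'a set" assume "open U" "open V" "U \<noteq> {}" "V \<noteq> {}"
  then have "\<exists>n\<ge>1. \<exists>x\<in>U. \<exists>y\<in>U. (f ^^ n) x \<in> V \<and> (f ^^ n) y \<in> V"
    by (intro assms[unfolded transitive_map_prod_iff, rule_format] conjI)
  then show "\<exists>n\<ge>1. (f ^^ n) ` U \<inter> V \<noteq> {}" by blast
qed

lemma generic_subset_CM1:
  assumes "compact (UNIV :: 'a::metric_space set)"
  shows "HM1u \<inter> WM \<subseteq> (CM1 :: ('a \<Rightarrow>\<^sub>C 'a) set)"
proof
  fix f :: "'a \<Rightarrow>\<^sub>C 'a" assume f: "f \<in> HM1u \<inter> WM"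
  obtain e where e: "apply_bcontfun f e = e" using f unfolding HM1u_def by blast
  have "chain_mixing (apply_bcontfun f)"
    by (rule transitive_fixed_imp_chain_mixing[of "apply_bcontfun f" e, OF assms weak_mixing_imp_transitive e])
       (use f in \<open>simp add: WM_def\<close>)
  then show "f \<in> CM1" using f e unfolding CM1_def WM_def by blast
qed

section \<open>Density of conjugacy classes\<close>

text \<open>
A clopen partition of small mesh, given as the map that sends a point to its cell. Two points share a
cell if they lie in the same members of a finite cover by small clopen sets.
\<close>

lemma fine_clopen_cells:
  assumes cantor: "cantor_space TYPE('a::metric_space)" and "\<epsilon> > 0"
  shows "\<exists>p :: 'a \<Rightarrow> 'a set. finite (range p) \<and> (\<forall>x. open (p x) \<and> closed (p x))
    \<and> (\<forall>x y. y \<in> p x \<longleftrightarrow> p y = p x) \<and> (\<forall>x. \<forall>y\<in>p x. dist x y < \<epsilon>)"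
proof -
  have comp: "compact (UNIV :: 'a set)" using cantor unfolding cantor_space_def by blast
  obtain \<B> :: "'a set set" where \<B>: "topological_basis \<B>" "\<forall>C\<in>\<B>. open C \<and> closed C"
    using cantor_space_countable_clopen_basis[OF cantor] by blast
  have "UNIV \<subseteq> \<Union>{C \<in> \<B>. \<exists>z. C \<subseteq> ball z (\<epsilon> / 2)}"
  proof
    fix x :: 'a
    obtain C where "C \<in> \<B>" "x \<in> C" "C \<subseteq> ball x (\<epsilon> / 2)"
      by (rule topological_basisE[OF \<B>(1), of "ball x (\<epsilon> / 2)" x]) (use assms(2) in auto)
    then show "x \<in> \<Union>{C \<in> \<B>. \<exists>z. C \<subseteq> ball z (\<epsilon> / 2)}" by blast
  qed
  then obtain F where F: "F \<subseteq> {C \<in> \<B>. \<exists>z. C \<subseteq> ball z (\<epsilon> / 2)}" "finite F" "UNIV \<subseteq> \<Union>F"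
    by (rule compactE[OF comp]) (use \<B>(2) in auto)
  define p where "p x = {y. \<forall>C\<in>F. y \<in> C \<longleftrightarrow> x \<in> C}" for x
  have clopen: "open (if b then C else - C)" "closed (if b then C else - C)" if "C \<in> F" for C b
    using that F(1) \<B>(2) by auto
  have p_Inter: "p x = (\<Inter>C\<in>F. if x \<in> C then C else - C)" for x
    unfolding p_def by (auto split: if_splits)
  have "open (p x)" "closed (p x)" for x
    unfolding p_Inter using clopen F(2) by (intro open_INT closed_INT ballI; simp only:)+
  moreover have "finite (range p)"
  proof (rule finite_surj[of "Pow F"])
    show "finite (Pow F)" using F(2) by simp
    show "range p \<subseteq> (\<lambda>G. {y. \<forall>C\<in>F. y \<in> C \<longleftrightarrow> C \<in> G}) ` Pow F"
    proof
      fix Q assume "Q \<in> range p"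
      then obtain x where "Q = p x" by blast
      then have "Q = {y. \<forall>C\<in>F. y \<in> C \<longleftrightarrow> C \<in> {C \<in> F. x \<in> C}}" unfolding p_def by auto
      then show "Q \<in> (\<lambda>G. {y. \<forall>C\<in>F. y \<in> C \<longleftrightarrow> C \<in> G}) ` Pow F" by blast
    qed
  qed
  moreover have "y \<in> p x \<longleftrightarrow> p y = p x" for x y
  proof
    show "y \<in> p x \<Longrightarrow> p y = p x" unfolding p_def by auto
    have "y \<in> p y" unfolding p_def by simp
    then show "p y = p x \<Longrightarrow> y \<in> p x" by simp
  qed
  moreover have "dist x y < \<epsilon>" if y: "y \<in> p x" for x y
  proof -
    obtain C where C: "C \<in> F" "x \<in> C" using F(3) by blast
    then obtain z where "C \<subseteq> ball z (\<epsilon> / 2)" using F(1) by blast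
    moreover have "y \<in> C" using y C unfolding p_def by blast
    ultimately have "dist z x < \<epsilon> / 2" "dist z y < \<epsilon> / 2" using C(2) by auto
    then show ?thesis by (rule dist_triangle_half_r)
  qed
  ultimately show ?thesis by blast
qed

definition walk :: "('v \<times> 'v) set \<Rightarrow> nat \<Rightarrow> (nat \<Rightarrow> 'v) \<Rightarrow> bool" where
  "walk E n w \<longleftrightarrow> (\<forall>i<n. (w i, w (Suc i)) \<in> E)"

lemma walk_append:
  assumes "walk E m u" "walk E n v" "u m = v 0"
  obtains w where "walk E (m + n) w" "w 0 = u 0" "w (m + n) = v n"
    "\<And>i. i < m \<Longrightarrow> w i = u i" "\<And>i. i \<le> n \<Longrightarrow> w (m + i) = v i"
proof
  let ?w = "\<lambda>i. if i < m then u i else v (i - m)"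
  show "walk E (m + n) ?w"
    unfolding walk_def
  proof (intro allI impI)
    fix i assume i: "i < m + n"
    consider "Suc i < m" | "Suc i = m" | "m \<le> i" by linarith
    then show "(?w i, ?w (Suc i)) \<in> E"
    proof cases
      case 1 then show ?thesis using assms(1) by (simp add: walk_def)
    next
      case 2 then show ?thesis using assms(1,3) by (auto simp: walk_def)
    next
      case 3
      then have "(v (i - m), v (Suc (i - m))) \<in> E" using assms(2) i by (simp add: walk_def)
      then show ?thesis using 3 by (simp add: Suc_diff_le)
    qed
  qed
  show "?w 0 = u 0" using assms(3) by (cases "m = 0") simp_all
qed auto

text \<open>
Closed walks based at \<open>a\<close> can be concatenated, so the vertices are visited one after another.
\<close>

lemma covering_closed_walk:
  assumes "finite S" "a \<in> S"
    and conn: "\<And>u v. u \<in> S \<Longrightarrow> v \<in> S \<Longrightarrow> (u, v) \<in> E\<^sup>*" and loop: "(a, a) \<in> E"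
  shows "\<exists>n w. n \<ge> 1 \<and> walk E n w \<and> w 0 = a \<and> w n = a \<and> S \<subseteq> w ` {..<n}"
proof -
  have reach: "\<exists>n w. walk E n w \<and> w 0 = u \<and> w n = v" if "u \<in> S" "v \<in> S" for u v
    using conn[OF that] by (auto simp: rtrancl_power relpow_fun_conv walk_def)
  have "\<exists>n w. n \<ge> 1 \<and> walk E n w \<and> w 0 = a \<and> w n = a \<and> T \<subseteq> w ` {..<n}"
    if "finite T" "T \<subseteq> S" for T
    using that
  proof (induction T rule: finite_induct)
    case empty
    show ?case using loop by (intro exI[of _ 1] exI[of _ "\<lambda>_. a"]) (simp add: walk_def)
  next
    case (insert v T)
    then obtain n w where w: "n \<ge> 1" "walk E n w" "w 0 = a" "w n = a" "T \<subseteq> w ` {..<n}" by auto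
    obtain k s where s: "walk E k s" "s 0 = a" "s k = v"
      using reach[of a v] assms(2) insert.prems by auto
    obtain l t where t: "walk E l t" "t 0 = v" "t l = a"
      using reach[of v a] assms(2) insert.prems by auto
    have "w n = s 0" using w(4) s(2) by simp
    from walk_append[OF w(2) s(1) this] obtain w1 where
      w1: "walk E (n + k) w1" "w1 0 = w 0" "w1 (n + k) = s k" "\<And>i. i < n \<Longrightarrow> w1 i = w i" by metis
    have "w1 (n + k) = t 0" using w1(3) s(3) t(2) by simp
    from walk_append[OF w1(1) t(1) this] obtain w2 where
      w2: "walk E (n + k + l) w2" "w2 0 = w1 0" "w2 (n + k + l) = t l" "\<And>i. i < n + k \<Longrightarrow> w2 i = w1 i"
        "w2 (n + k) = t 0" by (metis add_0_right le0)
    \<comment> \<open>One step along the loop makes time \<open>n + k\<close> smaller than the length even if \<open>l = 0\<close>.\<close>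
    let ?c = "\<lambda>i :: nat. a"
    have "walk E 1 ?c" using loop by (simp add: walk_def)
    moreover have "w2 (n + k + l) = a" using w2(3) t(3) by simp
    ultimately obtain w3 where
      w3: "walk E (n + k + l + 1) w3" "w3 0 = w2 0" "w3 (n + k + l + 1) = a"
         "\<And>i. i < n + k + l \<Longrightarrow> w3 i = w2 i" "w3 (n + k + l) = a"
      using walk_append[OF w2(1), of 1 ?c] by (metis add_0_right le0)
    have w3_w: "w3 i = w i" if "i < n" for i using that w1(4) w2(4) w3(4) by simp
    have "w i \<in> w3 ` {..<n + k + l + 1}" if "i < n" for i
      using w3_w[OF that] that by (intro image_eqI[of _ _ i]) auto
    then have "T \<subseteq> w3 ` {..<n + k + l + 1}" using w(5) by blast
    moreover have "v \<in> w3 ` {..<n + k + l + 1}"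
    proof (rule image_eqI[of _ _ "n + k"])
      show "v = w3 (n + k)" using w2(5) t(2,3) w3(4)[of "n + k"] w3(5) by (cases "l = 0") auto
    qed simp
    moreover have "w3 0 = a" using w3(2) w2(2) w1(2) w(3) by simp
    ultimately show ?case using w3(1,3) by (intro exI[of _ "n + k + l + 1"] exI[of _ w3]) simp
  qed
  from this[OF assms(1) subset_refl] show ?thesis .
qed

lemma continuous_on_funpow:
  fixes f :: "'a::topological_space \<Rightarrow> 'a"
  assumes "continuous_on UNIV f"
  shows "continuous_on UNIV (f ^^ n)"
proof (induction n)
  case (Suc n)
  show ?case
    using continuous_on_compose[OF Suc.IH continuous_on_subset[OF assms subset_UNIV]] by simp
qed (simp add: id_def)

text \<open>
A small neighbourhood of a point that is not periodic is disjoint from its first images.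
\<close>

lemma wandering_clopen:
  assumes cantor: "cantor_space TYPE('a::metric_space)"
    and cont: "continuous_on UNIV (g :: 'a \<Rightarrow> 'a)" and x: "\<And>i. i \<ge> 1 \<Longrightarrow> (g ^^ i) x \<noteq> x"
  shows "\<exists>A. open A \<and> closed A \<and> x \<in> A \<and> (\<forall>y\<in>A. \<forall>i. 1 \<le> i \<and> i < L \<longrightarrow> (g ^^ i) y \<notin> A)"
proof -
  obtain \<B> :: "'a set set" where \<B>: "topological_basis \<B>" "\<forall>C\<in>\<B>. open C \<and> closed C"
    using cantor_space_countable_clopen_basis[OF cantor] by blast
  have "\<exists>U V. open U \<and> open V \<and> x \<in> U \<and> (g ^^ i) x \<in> V \<and> U \<inter> V = {}" if i: "i \<in> {1..<L}" for i
    using hausdorff[of x "(g ^^ i) x"] x[of i] i by auto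
  then obtain U V where UV: "\<And>i. i \<in> {1..<L} \<Longrightarrow> open (U i) \<and> open (V i) \<and> x \<in> U i \<and> (g ^^ i) x \<in> V i \<and> U i \<inter> V i = {}"
    by metis
  note pow = continuous_on_funpow[OF cont]
  let ?W = "\<Inter>i\<in>{1..<L}. U i \<inter> (g ^^ i) -` V i"
  have "open ?W" using UV pow by (intro open_INT) (auto intro!: open_Int open_vimage)
  moreover have "x \<in> ?W" using UV by auto
  ultimately obtain A where A: "A \<in> \<B>" "x \<in> A" "A \<subseteq> ?W"
    by (rule topological_basisE[OF \<B>(1)])
  have "(g ^^ i) y \<notin> A" if "y \<in> A" "1 \<le> i" "i < L" for y i
  proof
    assume "(g ^^ i) y \<in> A"
    then have "(g ^^ i) y \<in> U i" "(g ^^ i) y \<in> V i" using A(3) that by auto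
    then show False using UV[of i] that by auto
  qed
  moreover have "open A" "closed A" using A(1) \<B>(2) by auto
  ultimately show ?thesis using A(2) by blast
qed

lemma glue_homeomorphism:
  fixes p q :: "'a::topological_space \<Rightarrow> 'b"
  assumes op: "\<And>Q. open (q -` {Q})" "\<And>Q. open (p -` {Q})"
    and hom: "\<And>Q. (q -` {Q}) homeomorphic (p -` {Q})"
  shows "\<exists>h k. homeomorphism UNIV UNIV h k \<and> (\<forall>y. p (h y) = q y)"
proof -
  have "\<exists>h k. homeomorphism (q -` {Q}) (p -` {Q}) h k" for Q
    using hom unfolding homeomorphic_def by blast
  then obtain h k where hk: "\<And>Q. homeomorphism (q -` {Q}) (p -` {Q}) (h Q) (k Q)" by metis
  have h: "p (h (q y) y) = q y" "k (q y) (h (q y) y) = y" for y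
    using hk[of "q y"] unfolding homeomorphism_def by auto
  have k: "q (k (p z) z) = p z" "h (p z) (k (p z) z) = z" for z
    using hk[of "p z"] unfolding homeomorphism_def by auto
  have glue: "continuous_on UNIV (\<lambda>y. f (r y) y)"
    if "\<And>Q. open (r -` {Q})" "\<And>Q. continuous_on (r -` {Q}) (f Q)"
    for r :: "'a \<Rightarrow> 'b" and f :: "'b \<Rightarrow> 'a \<Rightarrow> 'a"
  proof -
    have "continuous_on (r -` {Q}) (\<lambda>y. f (r y) y)" for Q
      by (rule continuous_on_eq[OF that(2)[of Q]]) simp
    then have "continuous_on (\<Union>Q\<in>UNIV. r -` {Q}) (\<lambda>y. f (r y) y)"
      using that(1) by (intro continuous_on_open_UN) auto
    moreover have "(\<Union>Q\<in>UNIV. r -` {Q}) = UNIV" by auto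
    ultimately show ?thesis by simp
  qed
  have "homeomorphism UNIV UNIV (\<lambda>y. h (q y) y) (\<lambda>z. k (p z) z)"
  proof (rule homeomorphismI)
    show "continuous_on UNIV (\<lambda>y. h (q y) y)"
      using hk by (intro glue op) (auto simp: homeomorphism_def)
    show "continuous_on UNIV (\<lambda>z. k (p z) z)"
      using hk by (intro glue op) (auto simp: homeomorphism_def)
  qed (use h k in auto)
  then show ?thesis using h(1) by blast
qed

text \<open>
The labelling argument outlined at the beginning. For a point \<open>y\<close>, let \<open>\<tau> y\<close> be the time since \<open>y\<close> last
visited \<open>A\<close>, cut off at \<open>L\<close>; its label is \<open>w (\<tau> y)\<close>. Points that have left \<open>A\<close> long ago
get the label \<open>w L\<close>, which is the loop, and as \<open>A\<close> does not return before time \<open>L\<close>, the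
clock \<open>\<tau>\<close> is never reset in the middle of the walk.
\<close>

lemma conj_class_approximates:
  assumes cantor: "cantor_space TYPE('a::metric_space)"
    and g: "g \<in> (homeos :: ('a \<Rightarrow>\<^sub>C 'a) set)"
    and x0: "\<And>i. i \<ge> 1 \<Longrightarrow> (apply_bcontfun g ^^ i) x0 \<noteq> x0"
    and f: "f \<in> (CM1 :: ('a \<Rightarrow>\<^sub>C 'a) set)" and \<epsilon>: "\<epsilon> > 0"
  shows "\<exists>F\<in>conj_class g. dist F f < \<epsilon>"
proof -
  let ?f = "apply_bcontfun f" and ?g = "apply_bcontfun g"
  have comp: "compact (UNIV :: 'a set)" using cantor unfolding cantor_space_def by blast
  obtain \<delta> where \<delta>: "\<delta> > 0" "\<And>x y. dist x y < \<delta> \<Longrightarrow> dist (?f x) (?f y) < \<epsilon> / 3"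
    using compact_uniformly_continuous[of UNIV ?f, OF _ comp] \<epsilon>
    unfolding uniformly_continuous_on_def by (metis UNIV_I continuous_on_apply_bcontfun zero_less_divide_iff zero_less_numeral)
  obtain p :: "'a \<Rightarrow> 'a set" where p: "finite (range p)" "\<And>x. open (p x)" "\<And>x. closed (p x)"
      "\<And>x y. y \<in> p x \<longleftrightarrow> p y = p x" "\<And>x y. y \<in> p x \<Longrightarrow> dist x y < min \<delta> (\<epsilon> / 3)"
    using fine_clopen_cells[OF cantor, of "min \<delta> (\<epsilon> / 3)"] \<delta>(1) \<epsilon> by auto
  \<comment> \<open>Lebesgue number of the partition: points closer than \<open>\<eta>\<close> share their cell.\<close>
  obtain \<eta> where \<eta>: "\<eta> > 0" "\<And>x y. dist x y < \<eta> \<Longrightarrow> p x = p y"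
  proof -
    have "UNIV \<subseteq> \<Union>(range p)" using p(4) by blast
    moreover have "\<And>G. G \<in> range p \<Longrightarrow> open G" using p(2) by auto
    ultimately obtain e where e: "e > 0" "\<And>x. x \<in> UNIV \<Longrightarrow> \<exists>G\<in>range p. ball x e \<subseteq> G"
      using Heine_Borel_lemma[OF comp, of "range p"] by metis
    have "p x = p y" if "dist x y < e" for x y
    proof -
      obtain z where z: "ball x e \<subseteq> p z" using e(2)[of x] by blast
      have "x \<in> p z" "y \<in> p z" using z that e(1) by auto
      then show ?thesis using p(4) by simp
    qed
    then show thesis using e(1) that by blast
  qed
  obtain e where e: "?f e = e" using f unfolding CM1_def by blast
  \<comment> \<open>The transition graph of \<open>f\<close> on cells; \<open>\<eta>\<close>-chains of \<open>f\<close> project to walks in it.\<close>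
  define E where "E = {(p x, p (?f x)) | x. True}"
  have step: "(p x, p y) \<in> E" if "(x, y) \<in> chain_step \<eta> ?f" for x y
  proof -
    obtain z where "dist x z < \<eta>" "dist (?f z) y < \<eta>" using \<open>(x, y) \<in> _\<close> unfolding chain_step_iff by blast
    then have "p x = p z" "p (?f z) = p y" using \<eta>(2) by blast+
    then show ?thesis unfolding E_def by auto
  qed
  have "chain_mixing ?f" using f unfolding CM1_def by blast
  then obtain N where N: "\<And>x y. (x, y) \<in> chain_step \<eta> ?f ^^ N"
    using \<eta>(1) unfolding chain_mixing_iff by meson
  have conn: "(u, v) \<in> E\<^sup>*" if "u \<in> range p" "v \<in> range p" for u v
    using that relpow_map[of "chain_step \<eta> ?f" p, OF step N] relpow_imp_rtrancl by blast
  have loop: "(p e, p e) \<in> E" unfolding E_def using e by force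
  have "\<exists>L w. L \<ge> 1 \<and> walk E L w \<and> w 0 = p e \<and> w L = p e \<and> range p \<subseteq> w ` {..<L}"
    by (rule covering_closed_walk[OF p(1) rangeI _ loop]) (rule conn)
  then obtain L w where w: "L \<ge> 1" "walk E L w" "w 0 = p e" "w L = p e" "range p \<subseteq> w ` {..<L}"
    by (elim exE conjE)
  have w_edge: "i < L \<Longrightarrow> (w i, w (Suc i)) \<in> E" for i using w(2) unfolding walk_def by blast

  obtain k where k: "homeomorphism UNIV UNIV ?g k" using g unfolding homeos_def by blast
  have kg: "k (?g y) = y" "?g (k y) = y" for y using k unfolding homeomorphism_def by auto
  have kpow: "continuous_on UNIV (k ^^ i)" for i
    using k unfolding homeomorphism_def by (intro continuous_on_funpow) blast
  have cancel: "(k ^^ i) ((?g ^^ i) y) = y" for i y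
    by (induction i arbitrary: y) (simp_all add: funpow_swap1 kg)
  obtain A where A: "open A" "closed A" "x0 \<in> A"
      "\<And>y i. y \<in> A \<Longrightarrow> 1 \<le> i \<Longrightarrow> i < L \<Longrightarrow> (?g ^^ i) y \<notin> A"
    using wandering_clopen[OF cantor _ x0, of L] by auto
  define \<tau> where "\<tau> y = (LEAST i. i = L \<or> (k ^^ i) y \<in> A)" for y
  have \<tau>_eq: "\<tau> y = i \<longleftrightarrow> i \<le> L \<and> (i = L \<or> (k ^^ i) y \<in> A) \<and> (\<forall>j<i. (k ^^ j) y \<notin> A)" for y i
  proof -
    have "\<tau> y \<le> L" unfolding \<tau>_def by (rule Least_le) simp
    moreover have "\<tau> y = L \<or> (k ^^ \<tau> y) y \<in> A" unfolding \<tau>_def by (rule LeastI[of _ L]) simp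
    moreover have "(k ^^ j) y \<notin> A" if "j < \<tau> y" for j using not_less_Least[of j] that unfolding \<tau>_def by blast
    ultimately show ?thesis by (metis linorder_neqE_nat nat_less_le not_le)
  qed
  have \<tau>_L: "\<tau> y \<le> L" for y using \<tau>_eq[of y "\<tau> y"] by simp
  have \<tau>_open: "open {y. \<tau> y = i}" for i
  proof (cases "i \<le> L")
    case True
    have "{y. \<tau> y = i} = (if i = L then UNIV else (k ^^ i) -` A) \<inter> (\<Inter>j\<in>{..<i}. (k ^^ j) -` (- A))"
      using True by (auto simp: \<tau>_eq)
    moreover have "open (if i = L then UNIV else (k ^^ i) -` A)"
      using A(1) kpow by (auto intro: open_vimage)
    moreover have "open (\<Inter>j\<in>{..<i}. (k ^^ j) -` (- A))"
      using A(2) kpow by (intro open_INT ballI open_vimage) auto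
    ultimately show ?thesis by (simp only: open_Int)
  next
    case False
    then show ?thesis by (simp add: \<tau>_eq)
  qed
  \<comment> \<open>\<open>\<tau>\<close> is either increased by one, kept at \<open>L\<close>, or reset to \<open>0\<close> from \<open>L - 1\<close> or \<open>L\<close>.\<close>
  have edge: "(w (\<tau> y), w (\<tau> (?g y))) \<in> E" for y
  proof (cases "?g y \<in> A")
    case True
    then have 0: "\<tau> (?g y) = 0" by (simp add: \<tau>_eq)
    show ?thesis
    proof (cases "\<tau> y = L")
      case True then show ?thesis using 0 w(3,4) loop by simp
    next
      case False
      then have "\<tau> y < L" "(k ^^ \<tau> y) y \<in> A" using \<tau>_eq[of y "\<tau> y"] by auto
      have "(?g ^^ Suc (\<tau> y)) ((k ^^ \<tau> y) y) = ?g y"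
      proof -
        have "(?g ^^ i) ((k ^^ i) y) = y" for i by (induction i arbitrary: y) (simp_all add: funpow_swap1 kg)
        then show ?thesis by simp
      qed
      then have "\<not> Suc (\<tau> y) < L" using A(4)[OF \<open>(k ^^ \<tau> y) y \<in> A\<close>, of "Suc (\<tau> y)"] \<open>?g y \<in> A\<close> by auto
      then have "Suc (\<tau> y) = L" using \<open>\<tau> y < L\<close> by simp
      then show ?thesis using w_edge[OF \<open>\<tau> y < L\<close>] 0 w(3,4) by simp
    qed
  next
    case False
    have preimage: "(k ^^ j) (?g y) \<in> A \<longleftrightarrow> (\<exists>i. j = Suc i \<and> (k ^^ i) y \<in> A)" for j
      using False by (cases j) (simp_all add: funpow_swap1 kg)
    show ?thesis
    proof (cases "\<tau> y = L")
      case True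
      then have "\<tau> (?g y) = L" using \<tau>_eq[of y L] \<tau>_eq[of "?g y" L] by (auto simp: preimage)
      then show ?thesis using True w(4) loop by simp
    next
      case False
      then have lt: "\<tau> y < L" using \<tau>_L[of y] by simp
      have "(k ^^ Suc (\<tau> y)) (?g y) \<in> A" "\<forall>j<Suc (\<tau> y). (k ^^ j) (?g y) \<notin> A"
        unfolding preimage using lt \<tau>_eq[of y "\<tau> y"] by auto
      then have "\<tau> (?g y) = Suc (\<tau> y)"
        unfolding \<tau>_eq[of "?g y"] using lt by (simp only: Suc_le_eq) blast
      then show ?thesis using w_edge[OF lt] by simp
    qed
  qed

  define lab where "lab y = w (\<tau> y)" for y
  have w_range: "w i \<in> range p" if "i \<le> L" for i
    using w_edge[of i] w(4) that unfolding E_def by (cases "i = L") auto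
  have lab_open: "open (lab -` \<Q>)" for \<Q>
  proof -
    have "lab -` \<Q> = (\<Union>i\<in>{i. w i \<in> \<Q>}. {y. \<tau> y = i})" unfolding lab_def by auto
    then show ?thesis using \<tau>_open by auto
  qed
  have hom: "lab -` {Q} homeomorphic p -` {Q}" for Q
  proof (cases "Q \<in> range p")
    case True
    then obtain x where x: "Q = p x" by blast
    then have pQ: "p -` {Q} = p x" using p(4) by auto
    obtain i where i: "i < L" "w i = Q" using w(5) True by auto
    have "\<tau> ((?g ^^ i) x0) = i"
    proof -
      have "(k ^^ j) ((?g ^^ i) x0) \<notin> A" if "j < i" for j
      proof -
        have "(?g ^^ i) x0 = (?g ^^ j) ((?g ^^ (i - j)) x0)"
          using that by (simp flip: funpow_add comp_apply[of "?g ^^ j"])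
        then have "(k ^^ j) ((?g ^^ i) x0) = (?g ^^ (i - j)) x0" using cancel by simp
        then show ?thesis using A(4)[OF A(3), of "i - j"] that i(1) by simp
      qed
      then show ?thesis using i(1) A(3) cancel[of i x0] by (simp add: \<tau>_eq)
    qed
    then have "(?g ^^ i) x0 \<in> lab -` {Q}" using i(2) by (simp add: lab_def)
    moreover have "closed (lab -` {Q})" using lab_open[of "- {Q}"] by (simp add: vimage_Compl open_closed)
    ultimately have "lab -` {Q} homeomorphic (UNIV :: (nat \<Rightarrow> bool) set)"
      using lab_open by (intro clopen_homeomorphic_cantor[OF cantor]) auto
    moreover have "p -` {Q} homeomorphic (UNIV :: (nat \<Rightarrow> bool) set)"
      unfolding pQ using p(2,3,4) by (intro clopen_homeomorphic_cantor[OF cantor]) auto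
    ultimately show ?thesis using homeomorphic_trans homeomorphic_sym by blast
  next
    case False
    then have "lab -` {Q} = {}" "p -` {Q} = {}" using w_range \<tau>_L unfolding lab_def by auto
    then show ?thesis by (simp add: homeomorphic_empty)
  qed
  have p_open: "open (p -` {Q})" for Q
  proof (cases "Q \<in> range p")
    case True
    then obtain x where "Q = p x" by blast
    then have "p -` {Q} = p x" using p(4) by auto
    then show ?thesis using p(2) by simp
  next
    case False
    then have "p -` {Q} = {}" by auto
    then show ?thesis by simp
  qed
  obtain h h' where h: "homeomorphism UNIV UNIV h h'" "\<And>y. p (h y) = lab y"
    using glue_homeomorphism[of lab p, OF lab_open p_open hom] by blast
  have hh: "h (h' z) = z" "continuous_on UNIV h" "continuous_on UNIV h'" for z
    using h(1) unfolding homeomorphism_def by auto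
  obtain H :: "'a \<Rightarrow>\<^sub>C 'a" where H: "apply_bcontfun H = h"
    using compact_continuous_is_bcontfun[OF comp hh(2)] by blast
  have "continuous_on UNIV (h \<circ> ?g \<circ> h')"
    by (intro continuous_on_compose hh continuous_on_subset[OF hh(2)]) simp_all
  then obtain F :: "'a \<Rightarrow>\<^sub>C 'a" where F: "apply_bcontfun F = h \<circ> ?g \<circ> h'"
    using compact_continuous_is_bcontfun[OF comp] by blast
  have "H \<in> homeos" unfolding homeos_def using h(1) H by auto
  then have "F \<in> conj_class g"
    unfolding conj_class_def using F H homeomorphism_inv_eq[OF h(1)] by blast
  moreover have "dist (apply_bcontfun F z) (?f z) \<le> 2 * \<epsilon> / 3" for z
  proof -
    let ?y = "h' z"
    have "p z = lab ?y" "p (apply_bcontfun F z) = lab (?g ?y)" using h(2) hh(1) F by (metis, simp)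
    then have "(p z, p (apply_bcontfun F z)) \<in> E" using edge[of ?y] unfolding lab_def by simp
    then obtain x where x: "p x = p z" "p (?f x) = p (apply_bcontfun F z)" unfolding E_def by auto
    have "dist (?f z) (?f x) < \<epsilon> / 3" using \<delta>(2) p(4)[of x z] p(5)[of x z] x(1) by simp
    moreover have "dist (apply_bcontfun F z) (?f x) < \<epsilon> / 3"
      using p(4)[of "?f x" "apply_bcontfun F z"] p(5)[of "?f x" "apply_bcontfun F z"] x(2) by simp
    ultimately show ?thesis
      using dist_triangle2[of "apply_bcontfun F z" "?f z" "?f x"] by simp
  qed
  then have "dist F f \<le> 2 * \<epsilon> / 3" by (rule dist_bound)
  then have "dist F f < \<epsilon>" using \<epsilon> by simp
  ultimately show ?thesis by blast
qed

section \<open>The generic homeomorphisms as a countable intersection of open sets\<close>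

text \<open>
Evaluation of iterates is jointly continuous in the map (for the sup metric) and the point. This is
what makes the conditions below open.
\<close>

lemma continuous_on_bcontfun_funpow:
  "continuous_on UNIV (\<lambda>(f :: 'a::metric_space \<Rightarrow>\<^sub>C 'a, x). (apply_bcontfun f ^^ n) x)"
proof (induction n)
  case 0
  show ?case by (simp add: case_prod_unfold continuous_on_snd)
next
  case (Suc n)
  have eval: "continuous_on UNIV (\<lambda>(f :: 'a \<Rightarrow>\<^sub>C 'a, x). apply_bcontfun f x)"
    unfolding continuous_on_iff
  proof (intro ballI allI impI)
    fix fx :: "('a \<Rightarrow>\<^sub>C 'a) \<times> 'a" and e :: real assume e: "0 < e"
    obtain f x where fx: "fx = (f, x)" by (cases fx)
    have "continuous_on UNIV (apply_bcontfun f)" by simp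
    then obtain d where d: "d > 0" "\<And>y. dist y x < d \<Longrightarrow> dist (apply_bcontfun f y) (apply_bcontfun f x) < e / 2"
      using e unfolding continuous_on_iff by (metis UNIV_I half_gt_zero)
    have "dist (apply_bcontfun g y) (apply_bcontfun f x) < e"
      if gy: "dist (g, y) (f, x) < min d (e / 2)" for g y
    proof -
      have "dist g f < e / 2" "dist y x < d"
        using gy dist_fst_le[of "(g, y)" "(f, x)"] dist_snd_le[of "(g, y)" "(f, x)"] by auto
      then have "dist (apply_bcontfun g y) (apply_bcontfun f y) < e / 2"
          "dist (apply_bcontfun f y) (apply_bcontfun f x) < e / 2"
        using dist_fun_lt_imp_dist_val_lt d(2) by blast+
      then show ?thesis
        using dist_triangle[of "apply_bcontfun g y" "apply_bcontfun f x" "apply_bcontfun f y"] by simp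
    qed
    then show "\<exists>d>0. \<forall>x'\<in>UNIV. dist x' fx < d \<longrightarrow>
        dist (case x' of (f, x) \<Rightarrow> apply_bcontfun f x) (case fx of (f, x) \<Rightarrow> apply_bcontfun f x) < e"
      using d(1) e fx by (intro exI[of _ "min d (e / 2)"]) auto
  qed
  have "continuous_on UNIV (\<lambda>p :: ('a \<Rightarrow>\<^sub>C 'a) \<times> 'a. (fst p, (\<lambda>(f, x). (apply_bcontfun f ^^ n) x) p))"
    by (intro continuous_on_Pair continuous_on_fst continuous_on_id Suc)
  from continuous_on_compose2[OF eval this]
  show ?case by (simp add: case_prod_unfold)
qed

lemma continuous_on_bcontfun_funpow_compose [continuous_intros]:
  fixes F :: "'c::topological_space \<Rightarrow> ('a::metric_space \<Rightarrow>\<^sub>C 'a)"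
  assumes "continuous_on S F" "continuous_on S \<xi>"
  shows "continuous_on S (\<lambda>s. (apply_bcontfun (F s) ^^ n) (\<xi> s))"
  using continuous_on_compose2[OF continuous_on_bcontfun_funpow continuous_on_Pair[OF assms]] by simp

lemma continuous_on_bcontfun_apply [continuous_intros]:
  fixes F :: "'c::topological_space \<Rightarrow> ('a::metric_space \<Rightarrow>\<^sub>C 'a)"
  assumes "continuous_on S F" "continuous_on S \<xi>"
  shows "continuous_on S (\<lambda>s. apply_bcontfun (F s) (\<xi> s))"
  using continuous_on_bcontfun_funpow_compose[OF assms, of 1] by simp

text \<open>
The tube lemma, in the form in which it shows that a condition on all points of a compact set is open.
\<close>

lemma open_all_in_compact:
  fixes W :: "('b::topological_space \<times> 'c::topological_space) set"
  assumes "compact K" "open W"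
  shows "open {f. \<forall>y\<in>K. (f, y) \<in> W}"
proof (subst open_subopen, safe)
  fix f assume f: "\<forall>y\<in>K. (f, y) \<in> W"
  then have "{f} \<times> K \<subseteq> W" by auto
  have "\<exists>A B. open A \<and> open B \<and> f \<in> A \<and> y \<in> B \<and> A \<times> B \<subseteq> W" if "y \<in> K" for y
    using open_prod_elim[OF assms(2), of "(f, y)"] f that by (metis mem_Sigma_iff)
  then obtain A B where AB: "\<And>y. y \<in> K \<Longrightarrow> open (A y) \<and> open (B y) \<and> f \<in> A y \<and> y \<in> B y \<and> A y \<times> B y \<subseteq> W"
    by metis
  have "K \<subseteq> (\<Union>y\<in>K. B y)" using AB by blast
  then obtain C where C: "C \<subseteq> K" "finite C" "K \<subseteq> (\<Union>y\<in>C. B y)"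
    by (rule compactE_image[OF assms(1), rotated]) (use AB in blast)+
  have "open (\<Inter>y\<in>C. A y)" using C AB by (intro open_INT) auto
  moreover have "f \<in> (\<Inter>y\<in>C. A y)" using C AB by auto
  moreover have "(\<Inter>y\<in>C. A y) \<subseteq> {f. \<forall>y\<in>K. (f, y) \<in> W}"
  proof safe
    fix g z assume g: "g \<in> (\<Inter>y\<in>C. A y)" and "z \<in> K"
    then obtain y where "y \<in> C" "z \<in> B y" using C(3) by blast
    then show "(g, z) \<in> W" using AB[of y] C(1) g by blast
  qed
  ultimately show "\<exists>T. open T \<and> f \<in> T \<and> T \<subseteq> {f. \<forall>y\<in>K. (f, y) \<in> W}" by blast
qed

definition nearly_injective :: "nat \<Rightarrow> ('a::metric_space \<Rightarrow>\<^sub>C 'a) set" where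
  "nearly_injective n = {f. \<forall>x y. apply_bcontfun f x = apply_bcontfun f y \<longrightarrow> dist x y < 1 / Suc n}"

definition nearly_one_fixed :: "nat \<Rightarrow> ('a::metric_space \<Rightarrow>\<^sub>C 'a) set" where
  "nearly_one_fixed n =
     {f. \<forall>x y. apply_bcontfun f x = x \<and> apply_bcontfun f y = y \<longrightarrow> dist x y < 1 / Suc n}"

text \<open>
For a homeomorphism \<open>f\<close> the condition says that every point \<open>x\<close> that \<open>f\<close> moves by at least
\<open>1 / (n + 1)\<close> has an iterate of order between \<open>-N\<close> and \<open>N\<close> in \<open>U\<close>. It is phrased for \<open>y = f\<^bsup>-N\<^esup> x\<close>, so that the
inverse of \<open>f\<close> does not occur and the set is visibly open.
\<close>

definition visits_within :: "nat \<Rightarrow> 'a set \<Rightarrow> nat \<Rightarrow> ('a::metric_space \<Rightarrow>\<^sub>C 'a) set" where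
  "visits_within n U N = {f. \<forall>y.
     dist ((apply_bcontfun f ^^ N) y) ((apply_bcontfun f ^^ Suc N) y) < 1 / Suc n
     \<or> (\<exists>j\<le>2 * N. (apply_bcontfun f ^^ j) y \<in> U)}"

definition mixes_at :: "nat \<Rightarrow> 'a set \<Rightarrow> 'a set \<Rightarrow> 'a set \<Rightarrow> 'a set \<Rightarrow> ('a::metric_space \<Rightarrow>\<^sub>C 'a) set" where
  "mixes_at n U1 V1 U2 V2 =
     {f. \<exists>x\<in>U1. \<exists>y\<in>U2. (apply_bcontfun f ^^ n) x \<in> V1 \<and> (apply_bcontfun f ^^ n) y \<in> V2}"

lemma open_Collect_dist_less:
  fixes c d :: "'c::topological_space \<Rightarrow> 'a::metric_space"
  assumes "continuous_on UNIV c" "continuous_on UNIV d"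
  shows "open {s. dist (c s) (d s) < r}"
  using assms by (intro open_Collect_less continuous_on_dist continuous_on_const)

lemma open_nearly_injective:
  assumes "compact (UNIV :: 'a::metric_space set)"
  shows "open (nearly_injective n :: ('a \<Rightarrow>\<^sub>C 'a) set)"
proof -
  let ?W = "{(f :: 'a \<Rightarrow>\<^sub>C 'a, x, y). apply_bcontfun f x \<noteq> apply_bcontfun f y}
    \<union> {(f :: 'a \<Rightarrow>\<^sub>C 'a, x, y). dist x y < 1 / Suc n}"
  have "open ?W"
    unfolding case_prod_unfold
    by (intro open_Un open_Collect_neq open_Collect_dist_less continuous_intros)
  then have "open {f. \<forall>z\<in>UNIV. (f, z) \<in> ?W}"
    using assms by (intro open_all_in_compact) (simp_all add: compact_Times flip: UNIV_Times_UNIV)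
  moreover have "nearly_injective n = {f. \<forall>z\<in>UNIV. (f, z) \<in> ?W}"
    unfolding nearly_injective_def by auto
  ultimately show ?thesis by (simp only:)
qed

lemma open_nearly_one_fixed:
  assumes "compact (UNIV :: 'a::metric_space set)"
  shows "open (nearly_one_fixed n :: ('a \<Rightarrow>\<^sub>C 'a) set)"
proof -
  let ?W = "{(f :: 'a \<Rightarrow>\<^sub>C 'a, x, y). apply_bcontfun f x \<noteq> x}
    \<union> {(f :: 'a \<Rightarrow>\<^sub>C 'a, x, y). apply_bcontfun f y \<noteq> y}
    \<union> {(f :: 'a \<Rightarrow>\<^sub>C 'a, x, y). dist x y < 1 / Suc n}"
  have "open ?W"
    unfolding case_prod_unfold
    by (intro open_Un open_Collect_neq open_Collect_dist_less continuous_intros)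
  then have "open {f. \<forall>z\<in>UNIV. (f, z) \<in> ?W}"
    using assms by (intro open_all_in_compact) (simp_all add: compact_Times flip: UNIV_Times_UNIV)
  moreover have "nearly_one_fixed n = {f. \<forall>z\<in>UNIV. (f, z) \<in> ?W}"
    unfolding nearly_one_fixed_def by auto
  ultimately show ?thesis by (simp only:)
qed

lemma open_visits_within:
  assumes "compact (UNIV :: 'a::metric_space set)" and U: "open U"
  shows "open (visits_within n U N :: ('a \<Rightarrow>\<^sub>C 'a) set)"
proof -
  let ?W = "{s :: ('a \<Rightarrow>\<^sub>C 'a) \<times> 'a.
       dist ((apply_bcontfun (fst s) ^^ N) (snd s)) ((apply_bcontfun (fst s) ^^ Suc N) (snd s)) < 1 / Suc n}
    \<union> (\<Union>j\<in>{..2 * N}. (\<lambda>s. (apply_bcontfun (fst s) ^^ j) (snd s)) -` U)"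
  have ev: "continuous_on UNIV (\<lambda>s :: ('a \<Rightarrow>\<^sub>C 'a) \<times> 'a. (apply_bcontfun (fst s) ^^ j) (snd s))" for j
    by (intro continuous_intros)
  have "open ?W"
    by (intro open_Un open_Collect_dist_less ev open_UN ballI open_vimage U)
  then have "open {f. \<forall>z\<in>UNIV. (f, z) \<in> ?W}"
    by (rule open_all_in_compact[OF assms(1)])
  moreover have "visits_within n U N = {f. \<forall>z\<in>UNIV. (f, z) \<in> ?W}"
    unfolding visits_within_def by (simp add: Bex_def)
  ultimately show ?thesis by (simp only:)
qed

lemma open_mixes_at:
  assumes "open V1" "open V2"
  shows "open (mixes_at n U1 V1 U2 V2 :: ('a::metric_space \<Rightarrow>\<^sub>C 'a) set)"
proof -
  have "mixes_at n U1 V1 U2 V2 = (\<Union>x\<in>U1. \<Union>y\<in>U2.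
      (\<lambda>f :: 'a \<Rightarrow>\<^sub>C 'a. (apply_bcontfun f ^^ n) x) -` V1 \<inter> (\<lambda>f. (apply_bcontfun f ^^ n) y) -` V2)"
    unfolding mixes_at_def by auto
  also have "open \<dots>"
    using assms by (intro open_UN ballI open_Int open_vimage continuous_intros)
  finally show ?thesis .
qed

text \<open>
The points moved by at least \<open>1 / (n + 1)\<close> form a compact set and none of them is fixed, so finitely
many iterates suffice to bring all of them into \<open>U\<close>.
\<close>

lemma generic_visits:
  fixes f :: "'a::metric_space \<Rightarrow>\<^sub>C 'a"
  assumes comp: "compact (UNIV :: 'a set)" and gen: "generic_on UNIV (apply_bcontfun f) g"
    and U: "open U" "U \<noteq> {}"
  shows "\<exists>N. f \<in> visits_within n U N"
proof -
  let ?f = "apply_bcontfun f"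
  have hom: "homeomorphism UNIV UNIV ?f g" by (rule generic_onD(1)[OF gen])
  have fg: "g (?f y) = y" "?f (g y) = y" "continuous_on UNIV g" for y
    using hom unfolding homeomorphism_def by auto
  let ?K = "{x. 1 / Suc n \<le> dist x (?f x)}"
  have "closed ?K"
    by (intro closed_Collect_le continuous_intros continuous_on_const continuous_on_apply_bcontfun)
  then have K: "compact ?K" using compact_Int_closed[OF comp, of ?K] by simp
  let ?V = "\<lambda>m. (?f ^^ m) -` U \<union> (g ^^ m) -` U"
  have op: "open (?V m)" for m
    using U(1) continuous_on_funpow[of ?f m] continuous_on_funpow[OF fg(3), of m]
    by (intro open_Un open_vimage) simp_all
  have "?K \<subseteq> (\<Union>m\<in>UNIV. ?V m)"
  proof
    fix x assume "x \<in> ?K"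
    then have "?f x \<noteq> x" by (auto simp: dist_commute)
    then show "x \<in> (\<Union>m\<in>UNIV. ?V m)" using generic_onD(3)[OF gen _ _ U(1)] U(2) by auto
  qed
  then obtain M where M: "finite M" "?K \<subseteq> (\<Union>m\<in>M. ?V m)"
    by (rule compactE_image[OF K op])
  have N: "m \<le> \<Sum>M" if "m \<in> M" for m using member_le_sum[of m M "\<lambda>m. m"] M(1) that by simp
  define N where "N = \<Sum>M"
  have cancel: "(g ^^ m) ((?f ^^ m) y) = y" for m y
    by (induction m arbitrary: y) (simp_all add: funpow_swap1 fg)
  have "\<exists>j\<le>2 * N. (?f ^^ j) y \<in> U" if "\<not> dist ((?f ^^ N) y) ((?f ^^ Suc N) y) < 1 / Suc n" for y
  proof -
    let ?x = "(?f ^^ N) y"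
    have "?x \<in> ?K" using that by simp
    then obtain m where m: "m \<in> M" "?x \<in> ?V m" using M(2) by blast
    have "m \<le> N" unfolding N_def by (rule N[OF m(1)])
    consider "(?f ^^ m) ?x \<in> U" | "(g ^^ m) ?x \<in> U" using m(2) by auto
    then show ?thesis
    proof cases
      case 1
      then have "(?f ^^ (m + N)) y \<in> U" by (simp add: funpow_add)
      then show ?thesis using \<open>m \<le> N\<close> by (intro exI[of _ "m + N"]) simp
    next
      case 2
      have "?x = (?f ^^ m) ((?f ^^ (N - m)) y)"
        using \<open>m \<le> N\<close> by (metis comp_apply funpow_add le_add_diff_inverse)
      then have "(?f ^^ (N - m)) y \<in> U" using 2 cancel by simp
      then show ?thesis by (intro exI[of _ "N - m"]) simp
    qed
  qed
  then have "f \<in> visits_within n U N" unfolding visits_within_def by blast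
  then show ?thesis ..
qed

lemma visits_within_imp_orbit:
  assumes fg: "\<And>y. apply_bcontfun f (g y) = y" "\<And>y. g (apply_bcontfun f y) = y"
    and f: "f \<in> visits_within n U N" and x: "1 / Suc n \<le> dist x (apply_bcontfun f x)"
  shows "\<exists>m. (apply_bcontfun f ^^ m) x \<in> U \<or> (g ^^ m) x \<in> U"
proof -
  let ?f = "apply_bcontfun f" and ?y = "(g ^^ N) x"
  have cancel: "(?f ^^ m) ((g ^^ m) z) = z" for m z
    by (induction m arbitrary: z) (simp_all add: funpow_swap1 fg)
  have "(?f ^^ Suc N) ?y = ?f x" using cancel by simp
  then have "\<not> dist ((?f ^^ N) ?y) ((?f ^^ Suc N) ?y) < 1 / Suc n"
    using x cancel[of N x] by simp
  then obtain j where j: "(?f ^^ j) ?y \<in> U" using f unfolding visits_within_def by blast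
  show ?thesis
  proof (cases "N \<le> j")
    case True
    have "(?f ^^ j) ?y = (?f ^^ (j - N)) x"
    proof -
      have "(?f ^^ j) ?y = (?f ^^ (j - N + N)) ?y" using True by simp
      also have "\<dots> = (?f ^^ (j - N)) ((?f ^^ N) ?y)" by (simp only: funpow_add comp_apply)
      finally show ?thesis using cancel by simp
    qed
    then show ?thesis using j by auto
  next
    case False
    then have "?y = (g ^^ (j + (N - j))) x" by simp
    then have "?y = (g ^^ j) ((g ^^ (N - j)) x)" by (simp only: funpow_add comp_apply)
    then have "(?f ^^ j) ?y = (g ^^ (N - j)) x" using cancel by simp
    then show ?thesis using j by (intro exI[of _ "N - j"]) simp
  qed
qed

lemma eq_if_dist_lt_all:
  fixes x y :: "'a::metric_space"
  assumes "\<And>n. dist x y < 1 / Suc n"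
  shows "x = y"
proof (rule ccontr)
  assume "x \<noteq> y"
  then obtain n where "1 / Suc n < dist x y" using nat_approx_posE[of "dist x y"] by auto
  then show False using assms[of n] by simp
qed

text \<open>
On a compact space a continuous bijection is a homeomorphism, so of the invertibility of \<open>f\<close> only
injectivity has to be expressed; that some fixed point exists is part of membership in \<^term>\<open>CM1\<close>.
\<close>

lemma generic_iff_countable_conditions:
  fixes \<B> :: "'a::metric_space set set"
  assumes comp: "compact (UNIV :: 'a set)" and \<B>: "topological_basis \<B>" and f: "f \<in> CM1"
  shows "f \<in> HM1u \<inter> WM \<longleftrightarrow>
      (\<forall>n. f \<in> nearly_injective n) \<and> (\<forall>n. f \<in> nearly_one_fixed n)
      \<and> (\<forall>n. \<forall>U\<in>\<B> - {{}}. f \<in> (\<Union>N. visits_within n U N))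
      \<and> (\<forall>U1\<in>\<B> - {{}}. \<forall>V1\<in>\<B> - {{}}. \<forall>U2\<in>\<B> - {{}}. \<forall>V2\<in>\<B> - {{}}.
           f \<in> (\<Union>n\<in>{1..}. mixes_at n U1 V1 U2 V2))" (is "_ \<longleftrightarrow> ?R")
proof -
  let ?f = "apply_bcontfun f"
  have op: "open U" "U \<noteq> {}" if "U \<in> \<B> - {{}}" for U
    using that topological_basis_open[OF \<B>] by auto
  show ?thesis
  proof
    assume "f \<in> HM1u \<inter> WM"
    then obtain g where g: "generic_on UNIV ?f g" using generic_iff by blast
    then have hom: "homeomorphism UNIV UNIV ?f g" by (rule generic_onD(1))
    have inj: "?f x = ?f y \<Longrightarrow> x = y" for x y using hom unfolding homeomorphism_def by (metis UNIV_I)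
    have fix1: "?f x = x \<Longrightarrow> ?f y = y \<Longrightarrow> x = y" for x y using generic_onD(2)[OF g] by blast
    show ?R
    proof (intro conjI allI ballI)
      show "f \<in> nearly_injective n" for n unfolding nearly_injective_def using inj by fastforce
      show "f \<in> nearly_one_fixed n" for n unfolding nearly_one_fixed_def using fix1 by fastforce
      show "f \<in> (\<Union>N. visits_within n U N)" if "U \<in> \<B> - {{}}" for n U
        using generic_visits[OF comp g op[OF that]] by simp
      show "f \<in> (\<Union>n\<in>{1..}. mixes_at n U1 V1 U2 V2)"
        if "U1 \<in> \<B> - {{}}" "V1 \<in> \<B> - {{}}" "U2 \<in> \<B> - {{}}" "V2 \<in> \<B> - {{}}" for U1 V1 U2 V2
        using generic_onD(4)[OF g, of U1 V1 U2 V2] op[OF that(1)] op[OF that(2)] op[OF that(3)] op[OF that(4)]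
        unfolding mixes_at_def by auto
    qed
  next
    assume R: ?R
    have basic: "\<exists>B\<in>\<B> - {{}}. B \<subseteq> U" if U: "open U" "U \<noteq> {}" for U :: "'a set"
    proof -
      obtain x where "x \<in> U" using U(2) by blast
      obtain B where "B \<in> \<B>" "x \<in> B" "B \<subseteq> U" by (rule topological_basisE[OF \<B> U(1) \<open>x \<in> U\<close>])
      then show ?thesis by blast
    qed
    have "inj ?f"
    proof (rule injI)
      fix x y assume "?f x = ?f y"
      then show "x = y" using R unfolding nearly_injective_def by (intro eq_if_dist_lt_all) blast
    qed
    moreover have "surj ?f" using f unfolding CM1_def cont_surj_def by blast
    ultimately obtain g where hom: "homeomorphism UNIV UNIV ?f g"
      using homeomorphism_compact[OF comp, of ?f UNIV] by auto
    then have fg: "\<And>y. ?f (g y) = y" "\<And>y. g (?f y) = y" unfolding homeomorphism_def by auto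
    have "generic_on UNIV ?f g"
      unfolding generic_on_def
    proof (intro conjI)
      obtain e where e: "?f e = e" using f unfolding CM1_def by blast
      show "\<exists>!x. x \<in> UNIV \<and> ?f x = x"
      proof (rule ex1I[of _ e])
        fix x assume "x \<in> UNIV \<and> ?f x = x"
        then show "x = e" using R e unfolding nearly_one_fixed_def by (intro eq_if_dist_lt_all) blast
      qed (simp add: e)
      show "\<forall>x\<in>UNIV. ?f x \<noteq> x \<longrightarrow> (\<forall>U. open U \<and> U \<inter> UNIV \<noteq> {} \<longrightarrow>
          (\<exists>n. (?f ^^ n) x \<in> U \<or> (g ^^ n) x \<in> U))"
      proof (intro ballI allI impI, elim conjE)
        fix x and U :: "'a set" assume x: "?f x \<noteq> x" and "open U" "U \<inter> UNIV \<noteq> {}"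
        then obtain B where B: "B \<in> \<B> - {{}}" "B \<subseteq> U" using basic[of U] by auto
        obtain n where n: "1 / Suc n < dist x (?f x)" using nat_approx_posE[of "dist x (?f x)"] x by auto
        obtain N where "f \<in> visits_within n B N" using R B(1) by blast
        then have "\<exists>m. (?f ^^ m) x \<in> B \<or> (g ^^ m) x \<in> B"
          using n by (intro visits_within_imp_orbit fg) auto
        then show "\<exists>n. (?f ^^ n) x \<in> U \<or> (g ^^ n) x \<in> U" using B(2) by blast
      qed
      show "\<forall>U1 V1 U2 V2. open U1 \<and> open V1 \<and> open U2 \<and> open V2
          \<and> U1 \<inter> UNIV \<noteq> {} \<and> V1 \<inter> UNIV \<noteq> {} \<and> U2 \<inter> UNIV \<noteq> {} \<and> V2 \<inter> UNIV \<noteq> {} \<longrightarrow>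
          (\<exists>n\<ge>1. \<exists>x\<in>UNIV \<inter> U1. \<exists>y\<in>UNIV \<inter> U2. (?f ^^ n) x \<in> V1 \<and> (?f ^^ n) y \<in> V2)"
      proof (intro allI impI, elim conjE)
        fix U1 V1 U2 V2 :: "'a set"
        assume "open U1" "open V1" "open U2" "open V2"
          "U1 \<inter> UNIV \<noteq> {}" "V1 \<inter> UNIV \<noteq> {}" "U2 \<inter> UNIV \<noteq> {}" "V2 \<inter> UNIV \<noteq> {}"
        then obtain A1 B1 A2 B2 where AB: "A1 \<in> \<B> - {{}}" "A1 \<subseteq> U1" "B1 \<in> \<B> - {{}}" "B1 \<subseteq> V1"
          "A2 \<in> \<B> - {{}}" "A2 \<subseteq> U2" "B2 \<in> \<B> - {{}}" "B2 \<subseteq> V2"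
          using basic[of U1] basic[of V1] basic[of U2] basic[of V2] by auto
        have "f \<in> (\<Union>n\<in>{1..}. mixes_at n A1 B1 A2 B2)" using R AB(1,3,5,7) by blast
        then obtain n x y where "n \<ge> 1" "x \<in> A1" "y \<in> A2" "(?f ^^ n) x \<in> B1" "(?f ^^ n) y \<in> B2"
          unfolding mixes_at_def by auto
        then show "\<exists>n\<ge>1. \<exists>x\<in>UNIV \<inter> U1. \<exists>y\<in>UNIV \<inter> U2. (?f ^^ n) x \<in> V1 \<and> (?f ^^ n) y \<in> V2"
          using AB(2,4,6,8) by blast
      qed
    qed (rule hom)
    then show "f \<in> HM1u \<inter> WM" using generic_iff by blast
  qed
qed

lemma gdelta_in_subspace_INT:
  assumes "countable I" "\<And>i. i \<in> I \<Longrightarrow> open (G i)"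
  shows "gdelta_in (top_of_set S) (S \<inter> (\<Inter>i\<in>I. G i))"
proof -
  have "gdelta_in (top_of_set S) (\<Inter>((\<lambda>i. S \<inter> G i) ` I \<union> {S}))"
  proof (rule gdelta_in_Inter)
    show "countable ((\<lambda>i. S \<inter> G i) ` I \<union> {S})" using assms(1) by simp
    fix T assume "T \<in> (\<lambda>i. S \<inter> G i) ` I \<union> {S}"
    then have "openin (top_of_set S) T" using assms(2) by (auto intro: openin_open_Int)
    then show "gdelta_in (top_of_set S) T" by (rule open_imp_gdelta_in)
  qed simp
  moreover have "\<Inter>((\<lambda>i. S \<inter> G i) ` I \<union> {S}) = S \<inter> (\<Inter>i\<in>I. G i)" by auto
  ultimately show ?thesis by (simp only:)
qed

lemma gdelta_generic:
  assumes cantor: "cantor_space TYPE('a::metric_space)"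
  shows "gdelta_in (top_of_set (CM1 :: ('a \<Rightarrow>\<^sub>C 'a) set)) (HM1u \<inter> WM)"
proof -
  have comp: "compact (UNIV :: 'a set)" using cantor unfolding cantor_space_def by blast
  obtain \<B> :: "'a set set" where \<B>: "countable \<B>" "topological_basis \<B>"
    using cantor_space_countable_clopen_basis[OF cantor] by blast
  let ?\<B> = "\<B> - {{}}" and ?C = "CM1 :: ('a \<Rightarrow>\<^sub>C 'a) set"
  have cnt: "countable ?\<B>" using \<B>(1) by simp
  have op: "open U" if "U \<in> ?\<B>" for U using that topological_basis_open[OF \<B>(2)] by auto
  have 1: "gdelta_in (top_of_set ?C) (?C \<inter> (\<Inter>n\<in>UNIV. nearly_injective n))"
    by (intro gdelta_in_subspace_INT open_nearly_injective comp) simp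
  have 2: "gdelta_in (top_of_set ?C) (?C \<inter> (\<Inter>n\<in>UNIV. nearly_one_fixed n))"
    by (intro gdelta_in_subspace_INT open_nearly_one_fixed comp) simp
  have 3: "gdelta_in (top_of_set ?C)
      (?C \<inter> (\<Inter>(n, U)\<in>UNIV \<times> ?\<B>. \<Union>N. visits_within n U N))"
    using cnt op by (intro gdelta_in_subspace_INT) (auto intro!: open_visits_within comp)
  have 4: "gdelta_in (top_of_set ?C)
      (?C \<inter> (\<Inter>(U1, V1, U2, V2)\<in>?\<B> \<times> ?\<B> \<times> ?\<B> \<times> ?\<B>. \<Union>n\<in>{1..}. mixes_at n U1 V1 U2 V2))"
    using cnt op by (intro gdelta_in_subspace_INT) (auto intro!: open_mixes_at countable_SIGMA)
  have "gdelta_in (top_of_set ?C)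
      ((?C \<inter> (\<Inter>n\<in>UNIV. nearly_injective n)) \<inter> (?C \<inter> (\<Inter>n\<in>UNIV. nearly_one_fixed n))
       \<inter> (?C \<inter> (\<Inter>(n, U)\<in>UNIV \<times> ?\<B>. \<Union>N. visits_within n U N))
       \<inter> (?C \<inter> (\<Inter>(U1, V1, U2, V2)\<in>?\<B> \<times> ?\<B> \<times> ?\<B> \<times> ?\<B>. \<Union>n\<in>{1..}. mixes_at n U1 V1 U2 V2)))"
    (is "gdelta_in _ ?G")
    by (rule gdelta_in_Int[OF gdelta_in_Int[OF gdelta_in_Int[OF 1 2] 3] 4])
  moreover have "?G = HM1u \<inter> WM"
  proof (intro set_eqI iffI)
    fix f assume f: "f \<in> ?G"
    then have "f \<in> ?C" by blast
    show "f \<in> HM1u \<inter> WM"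
      unfolding generic_iff_countable_conditions[OF comp \<B>(2) \<open>f \<in> ?C\<close>] using f by auto
  next
    fix f :: "'a \<Rightarrow>\<^sub>C 'a" assume f: "f \<in> HM1u \<inter> WM"
    then have "f \<in> ?C" using generic_subset_CM1[OF comp] by blast
    then show "f \<in> ?G"
      using f unfolding generic_iff_countable_conditions[OF comp \<B>(2) \<open>f \<in> ?C\<close>] by auto
  qed
  ultimately show ?thesis by (simp only:)
qed

section \<open>Density of the generic homeomorphisms\<close>

text \<open>
The orbit of a periodic point is finite, hence closed. If the point is not fixed, then this orbit is
also dense, although it does not contain the fixed point.
\<close>

lemma generic_has_aperiodic_point:
  assumes cantor: "cantor_space TYPE('a::metric_space)"
    and gen: "generic_on (UNIV :: 'a set) f g"
  shows "\<exists>x. \<forall>i\<ge>1. (f ^^ i) x \<noteq> x"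
proof -
  obtain e where e: "f e = e" using generic_onD(2)[OF gen] by blast
  have "\<not> open {e}" using cantor unfolding cantor_space_def islimpt_def by blast
  then obtain x where x: "x \<noteq> e" by (metis UNIV_eq_I open_UNIV singleton_iff)
  have fg: "g (f y) = y" "f (g y) = y" for y using generic_onD(1)[OF gen] unfolding homeomorphism_def by auto
  have nonfixed: "f x \<noteq> x" using x e generic_onD(2)[OF gen] by blast
  have "(f ^^ i) x \<noteq> x" if "i \<ge> 1" for i
  proof
    assume per: "(f ^^ i) x = x"
    let ?O = "(\<lambda>j. (f ^^ j) x) ` {..<i}"
    have forward: "(f ^^ n) x \<in> ?O" for n
      using funpow_mod_eq[OF per, of n] that by (intro image_eqI[of _ _ "n mod i"]) auto
    have cancel: "(g ^^ j) ((f ^^ j) z) = z" for j z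
      by (induction j arbitrary: z) (simp_all add: funpow_swap1 fg)
    have "(g ^^ n) x \<in> ?O" for n
    proof -
      have "n \<le> n * i" using that by simp
      then have "(f ^^ n) ((f ^^ (n * i - n)) x) = (f ^^ (n * i)) x"
        by (metis comp_apply funpow_add le_add_diff_inverse)
      also have "\<dots> = x" using funpow_mod_eq[OF per, of "n * i"] by simp
      finally have "(g ^^ n) x = (f ^^ (n * i - n)) x" using cancel by metis
      then show ?thesis using forward by simp
    qed
    with forward have "(f ^^ n) x \<in> ?O \<and> (g ^^ n) x \<in> ?O" for n by blast
    moreover have "e \<notin> ?O"
    proof
      assume "e \<in> ?O"
      then obtain j where "e = (f ^^ j) x" by auto
      moreover have "(f ^^ j) e = e" by (induction j) (simp_all add: e)
      ultimately show False using x cancel by metis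
    qed
    moreover have "open (- ?O)" by (simp add: finite_imp_closed open_Compl)
    ultimately show False
      using generic_onD(3)[OF gen _ nonfixed, of "- ?O"] by blast
  qed
  then show ?thesis by blast
qed

lemma generic_dense_conj_class:
  fixes g :: "'a::metric_space \<Rightarrow>\<^sub>C 'a"
  assumes cantor: "cantor_space TYPE('a)" and g: "g \<in> HM1u \<inter> WM"
  shows "CM1 \<subseteq> closure (conj_class g)"
proof
  fix f :: "'a \<Rightarrow>\<^sub>C 'a" assume f: "f \<in> CM1"
  obtain g' where "generic_on UNIV (apply_bcontfun g) g'" using g generic_iff by blast
  then obtain x0 where x0: "\<And>i. i \<ge> 1 \<Longrightarrow> (apply_bcontfun g ^^ i) x0 \<noteq> x0"
    using generic_has_aperiodic_point[OF cantor] by blast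
  have "g \<in> homeos" using g unfolding HM1u_def by blast
  then show "f \<in> closure (conj_class g)"
    unfolding closure_approachable using conj_class_approximates[OF cantor _ x0 f] by blast
qed

theorem theorem4p16:
  assumes "cantor_space TYPE('a::metric_space)"
  shows "(\<exists>f \<in> (HM1u :: ('a \<Rightarrow>\<^sub>C 'a) set). conj_transitive_element f CM1) \<and>
         gdelta_in (top_of_set (CM1 :: ('a \<Rightarrow>\<^sub>C 'a) set)) (HM1u \<inter> WM) \<and>
         top_of_set (CM1 :: ('a \<Rightarrow>\<^sub>C 'a) set) closure_of (HM1u \<inter> WM) = CM1"
proof (intro conjI)
  have comp: "compact (UNIV :: 'a set)" using assms unfolding cantor_space_def by blast
  have closed: "closedin (top_of_set cont_surj) (CM1 :: ('a \<Rightarrow>\<^sub>C 'a) set)"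
    by (rule closedin_CM1[OF comp])
  obtain g :: "'a \<Rightarrow>\<^sub>C 'a" where g: "g \<in> HM1u \<inter> WM" using generic_exists[OF assms] by blast
  have g_CM1: "g \<in> CM1" using g generic_subset_CM1[OF comp] by blast
  have class_sub: "conj_class g \<subseteq> CM1" by (rule conj_class_CM1[OF comp g_CM1])
  have dense: "CM1 \<subseteq> closure (conj_class g)" by (rule generic_dense_conj_class[OF assms g])
  have sub: "CM1 \<subseteq> (cont_surj :: ('a \<Rightarrow>\<^sub>C 'a) set)" unfolding CM1_def by blast
  have "top_of_set cont_surj closure_of conj_class g = CM1"
  proof
    show "top_of_set cont_surj closure_of conj_class g \<subseteq> CM1"
      using closed class_sub by (rule closure_of_minimal[rotated])
    show "CM1 \<subseteq> top_of_set cont_surj closure_of conj_class g"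
      using dense sub class_sub by (simp add: closure_of_subtopology Int_absorb1)
  qed
  moreover have "conj_invariant (CM1 :: ('a \<Rightarrow>\<^sub>C 'a) set)"
    unfolding conj_invariant_def using conj_class_CM1[OF comp] by blast
  ultimately have "conj_transitive_element g CM1"
    unfolding conj_transitive_element_def using closed g_CM1 by simp
  then show "\<exists>f \<in> (HM1u :: ('a \<Rightarrow>\<^sub>C 'a) set). conj_transitive_element f CM1" using g by blast
  show "gdelta_in (top_of_set (CM1 :: ('a \<Rightarrow>\<^sub>C 'a) set)) (HM1u \<inter> WM)"
    by (rule gdelta_generic[OF assms])
  have "closure (conj_class g) \<subseteq> closure (HM1u \<inter> WM)"
    by (rule closure_mono[OF generic_conj[OF comp g]])
  then have "CM1 \<subseteq> closure (HM1u \<inter> WM :: ('a \<Rightarrow>\<^sub>C 'a) set)" using dense by blast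
  then show "top_of_set (CM1 :: ('a \<Rightarrow>\<^sub>C 'a) set) closure_of (HM1u \<inter> WM) = CM1"
    using generic_subset_CM1[OF comp] by (simp add: closure_of_subtopology Int_absorb1 Int_absorb2)
qed

end
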